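(* Under the standing assumptions (A1)–(A3) below, there exists $c>0$ such that the iterates $X^k$ of the 3-splitting proximal point ADMM satisfy, for all $k\ge1$, $$\frac1k\sum_{l=1}^k\|\nabla\mathcal{L}_\beta^{3s}(X^l)\|_F\le\frac{c}{\sqrt k}\qquad\text{and}\qquad\min_{1\le l\le k}\|\nabla\mathcal{L}_\beta^{3s}(X^l)\|_F\le\frac{c}{\sqrt k}.$$
   Context: Data $X\in\mathbb{R}^{d\times n}$, $Y\in\mathbb{R}^{q\times n}$, $N\ge3$, $\lambda,\mu>0$, $\beta_1,\dots,\beta_N>0$. Activations $\sigma_i$ ($i\le N-1$) real analytic with $|\sigma_i|\le\psi_0,|\sigma_i'|\le\psi_1,|\sigma_i''|\le\psi_2$ on $\mathbb{R}$ ($\psi_j>0$), applied entrywise. $\|\cdot\|_F$ Frobenius norm, $\langle A,B\rangle=\mathrm{tr}(AB^T)$, $V_0:=X$. Variables $W_i\in\mathbb{R}^{d\times d}$, $U_i,V_i,\Lambda_i\in\mathbb{R}^{d\times n}$ ($i\le N-1$), $W_N\in\mathbb{R}^{q\times d}$, $V_N,\Lambda_N\in\mathbb{R}^{q\times n}$; $\nabla$ is the gradient with respect to all these blocks. $\mathcal{L}_\beta^{3s}=\tfrac12\|V_N-Y\|_F^2+\tfrac\lambda2\sum_{i=1}^N\|W_i\|_F^2+\tfrac\mu2\sum_{i=1}^{N-1}\|V_{i-1}+\sigma_i(U_i)-V_i\|_F^2+\sum_{i=1}^{N-1}(\langle\Lambda_i,W_iV_{i-1}-U_i\rangle+\tfrac{\beta_i}2\|W_iV_{i-1}-U_i\|_F^2)+\langle\Lambda_N,W_NV_{N-1}-V_N\rangle+\tfrac{\beta_N}2\|W_NV_{N-1}-V_N\|_F^2$.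 3-splitting proximal point ADMM: arbitrary $W_i^0$; $U_i^0=W_i^0V_{i-1}^0$, $V_i^0=V_{i-1}^0+\sigma_i(U_i^0)$ ($i\le N-1$), $V_N^0=W_N^0V_{N-1}^0$, $\Lambda_i^0=O$; positive parameters $\omega_i^k$. For $k\ge1$: (a) $W_i^k=\arg\min_{W_i}\{\tfrac\lambda2\|W_i\|_F^2+\tfrac{\beta_i}2\|W_iV_{i-1}^{k-1}-U_i^{k-1}+\Lambda_i^{k-1}/\beta_i\|_F^2\}$ ($i\le N-1$) and $W_N^k=\arg\min\{\tfrac\lambda2\|W_N\|_F^2+\tfrac{\beta_N}2\|W_NV_{N-1}^{k-1}-V_N^{k-1}+\Lambda_N^{k-1}/\beta_N\|_F^2\}$; (b) for $i=1,\dots,N-1$ in order: $U_i^k$ is a (fixed) minimizer of $\tfrac\mu2\|V_{i-1}^k+\sigma_i(U_i)-V_i^{k-1}\|_F^2+\tfrac{\beta_i}2\|U_i-W_i^kV_{i-1}^k-\Lambda_i^{k-1}/\beta_i\|_F^2+\tfrac{\omega_i^{k-1}}2\|U_i-U_i^{k-1}\|_F^2$; then, if $i\le N-2$, $V_i^k=\arg\min_{V_i}\{\tfrac\mu2\|V_{i-1}^k+\sigma_i(U_i^k)-V_i\|_F^2+\tfrac\mu2\|V_i+\sigma_{i+1}(U_{i+1}^{k-1})-V_{i+1}^{k-1}\|_F^2+\tfrac{\beta_{i+1}}2\|W_{i+1}^kV_i-U_{i+1}^{k-1}+\Lambda_{i+1}^{k-1}/\beta_{i+1}\|_F^2\}$,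 and if $i=N-1$, $V_{N-1}^k=\arg\min\{\tfrac\mu2\|V_{N-1}-V_{N-2}^k-\sigma_{N-1}(U_{N-1}^k)\|_F^2+\tfrac{\beta_N}2\|W_N^kV_{N-1}-V_N^{k-1}+\Lambda_N^{k-1}/\beta_N\|_F^2\}$; (c) $V_N^k=\frac1{1+\beta_N}(Y+\beta_NW_N^kV_{N-1}^k+\Lambda_N^{k-1})$; (d) $\Lambda_i^k=\Lambda_i^{k-1}+\beta_i(W_i^kV_{i-1}^k-U_i^k)$ ($i\le N-1$), $\Lambda_N^k=\Lambda_N^{k-1}+\beta_N(W_N^kV_{N-1}^k-V_N^k)$. $X^k$ collects all blocks at iteration $k$. Assumptions: fix $\mathcal{V}_0^{\max}>\|X\|_F$ and $\mathcal{V}_1^{\max},\dots,\mathcal{V}_{N-1}^{\max}>0$; let $a_i:=\psi_0\psi_2+\psi_1^2+\mathcal{V}_i^{\max}\psi_2+\mathcal{V}_{i-1}^{\max}\psi_2$. (A1) $\beta_i>\max\{32(1+\sqrt2)\mu a_i,\,16\mu\psi_1^2\}$ for $i\le N-1$, and $\beta_N>1$. (A2) With $\Delta_i:=(\beta_i/4-8\mu a_i)^2-128\mu^2a_i^2$, $\hat\epsilon_i\in(0,\sqrt{\Delta_i}/32)$, $\omega_i^{\min}:=\frac{\beta_i/4-8\mu a_i-\sqrt{\Delta_i}}{16}+\hat\epsilon_i$, $\epsilon_i\in(0,\omega_i^{\min}/4)$, $\omega_i^{\max}:=\min\{\frac{\beta_i/4-8\mu a_i+\sqrt{\Delta_i}}{16}-\hat\epsilon_i,\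 \sqrt{(\omega_i^{\min})^2+\beta_i\omega_i^{\min}/16-\beta_i\epsilon_i/4}\}$, the parameters satisfy $\omega_i^{\min}<\omega_i^k\le\omega_i^{k+1}<\omega_i^{\max}$ for all $k\ge0$, $i\le N-1$. (A3) The generated iterates satisfy $\|V_i^k\|_F\le\mathcal{V}_i^{\max}$ for all $i\le N-1$, $k\ge0$. *)

theory Defs
  imports "HOL-Analysis.Analysis"
begin

text \<open>Matrices are represented as functions nat => nat => real; every operation
 carries explicit dimensions and only looks at entries inside the stated range.
 Layer-indexed blocks are functions nat => mat (layers 1..N).\<close>

type_synonym mat = "nat \<Rightarrow> nat \<Rightarrow> real"

definition fsq :: "nat \<Rightarrow> nat \<Rightarrow> mat \<Rightarrow> real" where
  "fsq r c A = (\<Sum>a<r. \<Sum>b<c. (A a b)^2)"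

definition frob :: "nat \<Rightarrow> nat \<Rightarrow> mat \<Rightarrow> real" where
  "frob r c A = sqrt (fsq r c A)"

definition minner :: "nat \<Rightarrow> nat \<Rightarrow> mat \<Rightarrow> mat \<Rightarrow> real" where
  "minner r c A B = (\<Sum>a<r. \<Sum>b<c. A a b * B a b)"

definition mmul :: "nat \<Rightarrow> mat \<Rightarrow> mat \<Rightarrow> mat" where
  "mmul m A B = (\<lambda>a b. \<Sum>k<m. A a k * B k b)"

definition meq :: "nat \<Rightarrow> nat \<Rightarrow> mat \<Rightarrow> mat \<Rightarrow> bool" where
  "meq r c A B \<longleftrightarrow> (\<forall>a<r. \<forall>b<c. A a b = B a b)"

definition Vz :: "mat \<Rightarrow> (nat \<Rightarrow> mat) \<Rightarrow> nat \<Rightarrow> mat" where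
  "Vz X V i = (if i = 0 then X else V i)"

text \<open>number of rows of W_i, V_i, Lambda_i\<close>
definition rw :: "nat \<Rightarrow> nat \<Rightarrow> nat \<Rightarrow> nat \<Rightarrow> nat" where
  "rw N d q i = (if i = N then q else d)"

definition real_analytic :: "(real \<Rightarrow> real) \<Rightarrow> bool" where
  "real_analytic f \<longleftrightarrow> (\<forall>x. \<exists>r>0. \<exists>c::nat\<Rightarrow>real.
      \<forall>y. \<bar>y - x\<bar> < r \<longrightarrow> (\<lambda>k. c k * (y - x)^k) sums f y)"

definition Lag :: "nat \<Rightarrow> nat \<Rightarrow> nat \<Rightarrow> nat \<Rightarrow> mat \<Rightarrow> mat \<Rightarrow> real \<Rightarrow> real \<Rightarrow>
    (nat \<Rightarrow> real) \<Rightarrow> (nat \<Rightarrow> real \<Rightarrow> real) \<Rightarrow>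
    (nat \<Rightarrow> mat) \<Rightarrow> (nat \<Rightarrow> mat) \<Rightarrow> (nat \<Rightarrow> mat) \<Rightarrow> (nat \<Rightarrow> mat) \<Rightarrow> real" where
  "Lag N d q n X Y lam mu beta sig W U V Lm =
     fsq q n (\<lambda>a b. V N a b - Y a b) / 2
   + lam / 2 * (\<Sum>i=1..N. fsq (rw N d q i) d (W i))
   + mu / 2 * (\<Sum>i=1..N-1. fsq d n (\<lambda>a b. Vz X V (i-1) a b + sig i (U i a b) - V i a b))
   + (\<Sum>i=1..N-1.
        minner d n (Lm i) (\<lambda>a b. mmul d (W i) (Vz X V (i-1)) a b - U i a b)
      + beta i / 2 * fsq d n (\<lambda>a b. mmul d (W i) (Vz X V (i-1)) a b - U i a b))
   + minner q n (Lm N) (\<lambda>a b. mmul d (W N) (Vz X V (N-1)) a b - V N a b)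
   + beta N / 2 * fsq q n (\<lambda>a b. mmul d (W N) (Vz X V (N-1)) a b - V N a b)"

definition upd :: "(nat \<Rightarrow> mat) \<Rightarrow> nat \<Rightarrow> nat \<Rightarrow> nat \<Rightarrow> real \<Rightarrow> (nat \<Rightarrow> mat)" where
  "upd F i a b t = F(i := (F i)(a := (F i a)(b := t)))"

definition gradnorm :: "nat \<Rightarrow> nat \<Rightarrow> nat \<Rightarrow> nat \<Rightarrow>
    ((nat \<Rightarrow> mat) \<Rightarrow> (nat \<Rightarrow> mat) \<Rightarrow> (nat \<Rightarrow> mat) \<Rightarrow> (nat \<Rightarrow> mat) \<Rightarrow> real) \<Rightarrow>
    (nat \<Rightarrow> mat) \<Rightarrow> (nat \<Rightarrow> mat) \<Rightarrow> (nat \<Rightarrow> mat) \<Rightarrow> (nat \<Rightarrow> mat) \<Rightarrow> real" where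
  "gradnorm N d q n L W U V Lm = sqrt (
      (\<Sum>i=1..N. \<Sum>a<rw N d q i. \<Sum>b<d. (deriv (\<lambda>t. L (upd W i a b t) U V Lm) (W i a b))^2)
    + (\<Sum>i=1..N-1. \<Sum>a<d. \<Sum>b<n. (deriv (\<lambda>t. L W (upd U i a b t) V Lm) (U i a b))^2)
    + (\<Sum>i=1..N. \<Sum>a<rw N d q i. \<Sum>b<n. (deriv (\<lambda>t. L W U (upd V i a b t) Lm) (V i a b))^2)
    + (\<Sum>i=1..N. \<Sum>a<rw N d q i. \<Sum>b<n. (deriv (\<lambda>t. L W U V (upd Lm i a b t)) (Lm i a b))^2))"


definition acoef :: "real \<Rightarrow> real \<Rightarrow> real \<Rightarrow> (nat \<Rightarrow> real) \<Rightarrow> nat \<Rightarrow> real" where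
  "acoef psi0 psi1 psi2 Vmax i = psi0 * psi2 + psi1^2 + Vmax i * psi2 + Vmax (i-1) * psi2"

definition Delta :: "real \<Rightarrow> real \<Rightarrow> real \<Rightarrow> real" where
  "Delta mu bet a = (bet/4 - 8*mu*a)^2 - 128 * mu^2 * a^2"

definition omin :: "real \<Rightarrow> real \<Rightarrow> real \<Rightarrow> real \<Rightarrow> real" where
  "omin mu bet a eh = (bet/4 - 8*mu*a - sqrt (Delta mu bet a)) / 16 + eh"

definition omax :: "real \<Rightarrow> real \<Rightarrow> real \<Rightarrow> real \<Rightarrow> real \<Rightarrow> real" where
  "omax mu bet a eh e = min ((bet/4 - 8*mu*a + sqrt (Delta mu bet a)) / 16 - eh)
      (sqrt ((omin mu bet a eh)^2 + bet * omin mu bet a eh / 16 - bet * e / 4))"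

end

(*
  No block update raises the augmented Lagrangian, and those of V and U lower it by a multiple of the
  squared change of the block, as the V-subproblems are strongly convex and U has a proximal term.
  The multiplier step raises it by |dLambda_i|^2 / beta_i. The stationarity condition of the
  U-subproblem expresses Lambda_i through the current V_{i-1}, U_i and the previous V_i, U_i, so
  |dLambda_i|^2 is controlled by squared changes of V and U over two consecutive sweeps. Adding the
  part that belongs to the older sweep to the Lagrangian gives a Lyapunov function, which (A1) and
  (A2) make decreasing and bounded below. Hence the differences of U, V, Lambda are square-summable
  in k, and W, V_N and Lambda are bounded. Every entry of the gradient at X^k, minus the
  stationarity condition of the corresponding subproblem, is a sum of bounded sequences times such
  differences, so the gradient norm is square-summable; Cauchy-Schwarz turns this into O(1/sqrt k).
*)

theory Submission
  imports Defs
begin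

subsection \<open>Matrix calculus\<close>

text \<open>The weight \<open>om\<close> cuts both ways. The U-subproblem is nonconvex, so its
  proximal term is the only source of decrease in U, \<open>om/2\<close> times the squared change;
  but stationarity puts \<open>om\<close> times the change of U into the multiplier, so
  \<open>om\<close> also enlarges the rise in the multiplier step. Squaring a sum of four terms
  costs a factor 4, and the balance is
  \<open>4 (mu a + om)^2 / beta + 4 om^2 / beta \<le> om / 4\<close>, that is,
  \<open>8 om^2 - (beta/4 - 8 mu a) om + 4 mu^2 a^2 \<le> 0\<close>. Its discriminant is
  \<open>Delta\<close>, positive once \<open>beta > 32 (1 + sqrt 2) mu a\<close>; (A2) keeps
  \<open>om\<close> between the roots. The constant \<open>a_i\<close> is a Lipschitz constant in u
  of \<open>(x + sig_i u - y) sig_i' u\<close>, finite because (A3) bounds x and y. The bound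
  \<open>16 mu psi1^2\<close> makes the V-part of the multiplier change cheaper than the strong
  convexity of the V-subproblem; \<open>beta_N > 1\<close> does the same for the output layer, where
  the multiplier is \<open>V_N - Y\<close>. Changes of W are never measured: W is updated first, so
  each stationarity condition already contains the new W, and its boundedness is enough.\<close>

definition munit :: "nat \<Rightarrow> nat \<Rightarrow> mat" where
  "munit a b = (\<lambda>x y. if x = a \<and> y = b then 1 else 0)"

lemma fsq_nonneg [simp]: "fsq r c A \<ge> 0"
  by (simp add: fsq_def sum_nonneg)

lemma fsq_cong: "(\<And>a b. a < r \<Longrightarrow> b < c \<Longrightarrow> A a b = B a b) \<Longrightarrow> fsq r c A = fsq r c B"
  by (simp add: fsq_def)

lemma entry_sq_le_fsq: "a < r \<Longrightarrow> b < c \<Longrightarrow> (A a b)^2 \<le> fsq r c A"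
  unfolding fsq_def
  by (rule order_trans[OF member_le_sum[of b "{..<c}" "\<lambda>b. (A a b)^2"]
        member_le_sum[of a "{..<r}" "\<lambda>a. \<Sum>b<c. (A a b)^2"]])
     (auto intro: sum_nonneg)

lemma fsq_le_sum4:
  assumes "\<And>a b. a < r \<Longrightarrow> b < c \<Longrightarrow> (A a b)^2 \<le>
     k1 * (A1 a b)^2 + k2 * (A2 a b)^2 + k3 * (A3 a b)^2 + k4 * (A4 a b)^2"
  shows "fsq r c A \<le> k1 * fsq r c A1 + k2 * fsq r c A2 + k3 * fsq r c A3 + k4 * fsq r c A4"
proof -
  have "fsq r c A \<le> (\<Sum>a<r. \<Sum>b<c. k1 * (A1 a b)^2 + k2 * (A2 a b)^2 + k3 * (A3 a b)^2 + k4 * (A4 a b)^2)"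
    unfolding fsq_def by (intro sum_mono assms) auto
  also have "\<dots> = k1 * fsq r c A1 + k2 * fsq r c A2 + k3 * fsq r c A3 + k4 * fsq r c A4"
    by (simp add: fsq_def sum.distrib sum_distrib_left)
  finally show ?thesis .
qed

lemma fsq_add_scaled:
  "fsq r c (\<lambda>a b. A a b + t * D a b) = fsq r c A + t * (2 * minner r c A D) + t^2 * fsq r c D"
  by (simp add: fsq_def minner_def sum.distrib sum_distrib_left power2_eq_square algebra_simps)

lemma fsq_minus_commute: "fsq r c (\<lambda>a b. A a b - B a b) = fsq r c (\<lambda>a b. B a b - A a b)"
  by (simp add: fsq_def power2_commute)

lemma mmul_add_scaled_left:
  "mmul m (\<lambda>a b. A a b + t * D a b) B = (\<lambda>a b. mmul m A B a b + t * mmul m D B a b)"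
  by (simp add: mmul_def sum.distrib sum_distrib_left algebra_simps)

lemma mmul_add_scaled_right:
  "mmul m A (\<lambda>a b. B a b + t * D a b) = (\<lambda>a b. mmul m A B a b + t * mmul m A D a b)"
  by (simp add: mmul_def sum.distrib sum_distrib_left algebra_simps)

lemma minner_munit: "a < r \<Longrightarrow> b < c \<Longrightarrow> minner r c A (munit a b) = A a b"
proof -
  assume "a < r" "b < c"
  have "minner r c A (munit a b) = (\<Sum>x<r. if x = a then (\<Sum>y<c. if y = b then A x y else 0) else 0)"
    unfolding minner_def munit_def
    by (intro sum.cong refl) (simp add: mult_if_delta sum.neutral if_distrib cong: if_cong)
  also have "\<dots> = A a b"
    using \<open>a < r\<close> \<open>b < c\<close> by (simp add: sum.delta)
  finally show ?thesis .
qed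

lemma mmul_munit_left: "b < m \<Longrightarrow> mmul m (munit a b) B = (\<lambda>x y. if x = a then B b y else 0)"
proof (intro ext)
  fix x y assume "b < m"
  have "mmul m (munit a b) B x y = (\<Sum>k<m. if k = b then (if x = a then B b y else 0) else 0)"
    unfolding mmul_def munit_def by (intro sum.cong) auto
  with \<open>b < m\<close> show "mmul m (munit a b) B x y = (if x = a then B b y else 0)"
    by (simp add: sum.delta)
qed

lemma mmul_munit_right: "a < m \<Longrightarrow> mmul m A (munit a b) = (\<lambda>x y. if y = b then A x a else 0)"
proof (intro ext)
  fix x y assume "a < m"
  have "mmul m A (munit a b) x y = (\<Sum>k<m. if k = a then (if y = b then A x a else 0) else 0)"
    unfolding mmul_def munit_def by (intro sum.cong) auto
  with \<open>a < m\<close> show "mmul m A (munit a b) x y = (if y = b then A x a else 0)"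
    by (simp add: sum.delta)
qed

lemma minner_mmul_munit_left:
  assumes "a < r" "b < m"
  shows "minner r c A (mmul m (munit a b) B) = (\<Sum>y<c. A a y * B b y)"
proof -
  have "minner r c A (mmul m (munit a b) B) = (\<Sum>x<r. if x = a then (\<Sum>y<c. A x y * B b y) else 0)"
    unfolding minner_def mmul_munit_left[OF assms(2)] by (intro sum.cong) auto
  with assms show ?thesis by (simp add: sum.delta)
qed

lemma minner_mmul_munit_right:
  assumes "a < m" "b < c"
  shows "minner r c A (mmul m B (munit a b)) = (\<Sum>x<r. A x b * B x a)"
proof -
  have "minner r c A (mmul m B (munit a b)) = (\<Sum>x<r. \<Sum>y<c. if y = b then A x y * B x a else 0)"
    unfolding minner_def mmul_munit_right[OF assms(1)] by (intro sum.cong) auto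
  with assms show ?thesis by (simp add: sum.delta)
qed

lemma minner_zero_right [simp]: "minner r c A (\<lambda>a b. 0) = 0"
  by (simp add: minner_def)

lemma minner_diff_right: "minner r c A (\<lambda>a b. B a b - C a b) = minner r c A B - minner r c A C"
  by (simp add: minner_def sum_subtractf algebra_simps)

lemma minner_scale_right: "minner r c A (\<lambda>a b. t * B a b) = t * minner r c A B"
  by (simp add: minner_def sum_distrib_left mult_ac)

lemma mmul_zero [simp]: "mmul m (\<lambda>a b. 0) B = (\<lambda>a b. 0)" "mmul m B (\<lambda>a b. 0) = (\<lambda>a b. 0)"
  by (simp_all add: mmul_def)

lemma fsq_has_derivative:
  assumes "\<And>a b. a < r \<Longrightarrow> b < c \<Longrightarrow> ((\<lambda>t. A t a b) has_real_derivative D a b) (at s)"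
  shows "((\<lambda>t. fsq r c (A t)) has_real_derivative 2 * minner r c (A s) D) (at s)"
  unfolding fsq_def minner_def sum_distrib_left
  by (intro DERIV_sum) (auto intro!: derivative_eq_intros assms)

lemma minner_has_derivative:
  assumes "\<And>a b. a < r \<Longrightarrow> b < c \<Longrightarrow> ((\<lambda>t. A t a b) has_real_derivative DA a b) (at s)"
    and "\<And>a b. a < r \<Longrightarrow> b < c \<Longrightarrow> ((\<lambda>t. B t a b) has_real_derivative DB a b) (at s)"
  shows "((\<lambda>t. minner r c (A t) (B t)) has_real_derivative
           minner r c (B s) DA + minner r c (A s) DB) (at s)"
  unfolding minner_def sum.distrib[symmetric]
  by (intro DERIV_sum) (auto intro!: derivative_eq_intros assms)

text \<open>A parabola in \<open>t\<close> with a minimum at 0 has no linear term. This takes the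
  place of matrix differential calculus: expanding a subproblem along a direction \<open>D\<close>
  already yields its stationarity condition.\<close>

lemma quadratic_along_arg_min:
  fixes F :: "mat \<Rightarrow> real"
  assumes min: "is_arg_min F (\<lambda>_. True) M"
    and quad: "\<And>t. F (\<lambda>a b. M a b + t * D a b) = F M + t * g + t^2 * h"
  shows "g = 0"
proof -
  have "((\<lambda>t. F M + t * g + t^2 * h) has_real_derivative g) (at 0)"
    by (auto intro!: derivative_eq_intros)
  moreover have "\<forall>t. \<bar>0 - t\<bar> < 1 \<longrightarrow> F M + 0 * g + 0^2 * h \<le> F M + t * g + t^2 * h"
    using min unfolding is_arg_min_linorder quad[symmetric] by simp
  ultimately show ?thesis
    using DERIV_local_min[of "\<lambda>t. F M + t * g + t^2 * h" g 0 1] by auto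
qed

text \<open>Since the linear term vanishes in every direction, the excess over the minimum is
  exactly the second-order part. For the V-subproblems that part is the guaranteed decrease.\<close>

lemma quadratic_growth_arg_min:
  fixes F :: "mat \<Rightarrow> real"
  assumes min: "is_arg_min F (\<lambda>_. True) M"
    and quad: "\<And>D t. F (\<lambda>a b. M a b + t * D a b) = F M + t * g D + t^2 * h D"
  shows "F M' = F M + h (\<lambda>a b. M' a b - M a b)"
  using quad[of 1 "\<lambda>a b. M' a b - M a b"]
    quadratic_along_arg_min[OF min quad[of _ "\<lambda>a b. M' a b - M a b"]]
  by simp

text \<open>The subproblems use the scaled penalty on the left, the Lagrangian an inner product plus
  a penalty; the two differ by a term in the multiplier alone, which no primal block sees.\<close>

lemma complete_square:
  assumes "bet \<noteq> 0"
  shows "bet / 2 * fsq r c (\<lambda>a b. A a b + L a b / bet)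
       = minner r c L A + bet / 2 * fsq r c A + fsq r c L / (2 * bet)"
proof -
  have "bet / 2 * (A a b + L a b / bet)^2
      = L a b * A a b + bet / 2 * (A a b)^2 + (L a b)^2 / (2 * bet)" for a b
    using assms by (simp add: field_simps power2_eq_square)
  then have "bet / 2 * fsq r c (\<lambda>a b. A a b + L a b / bet)
      = (\<Sum>a<r. \<Sum>b<c. L a b * A a b + bet / 2 * (A a b)^2 + (L a b)^2 / (2 * bet))"
    unfolding fsq_def sum_distrib_left by (simp only:)
  then show ?thesis
    by (simp add: fsq_def minner_def sum.distrib sum_distrib_left sum_divide_distrib)
qed

lemma square_sum4_le: "(a + b + c + e)^2 \<le> 4 * (a^2 + b^2 + c^2 + e^2 :: real)"
proof -
  have "0 \<le> (a-b)^2 + (a-c)^2 + (a-e)^2 + (b-c)^2 + (b-e)^2 + (c-e)^2" by simp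
  then show ?thesis by (simp add: power2_eq_square algebra_simps)
qed

lemma square_sum2_le: "(a + b)^2 \<le> 2 * a^2 + 2 * (b^2 :: real)"
  using zero_le_power2[of "a - b"] by (simp add: power2_sum power2_diff)

subsection \<open>Square-summable sequences\<close>

definition l2 :: "(nat \<Rightarrow> real) \<Rightarrow> bool" where
  "l2 f \<longleftrightarrow> summable (\<lambda>k. (f k)^2)"

lemma l2_comparison:
  assumes "l2 g" and "\<And>k. \<bar>f k\<bar> \<le> \<bar>g k\<bar>"
  shows "l2 f"
  unfolding l2_def
  by (rule summable_comparison_test'[OF assms(1)[unfolded l2_def], of 0])
     (use assms(2) in \<open>simp add: abs_le_square_iff\<close>)

lemma l2_cmult: "l2 f \<Longrightarrow> l2 (\<lambda>k. c * f k)"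
  unfolding l2_def power_mult_distrib by (rule summable_mult)

lemma l2_add:
  assumes "l2 f" "l2 g"
  shows "l2 (\<lambda>k. f k + g k)"
  unfolding l2_def
proof (rule summable_comparison_test'[where N = 0])
  show "summable (\<lambda>k. 2 * (f k)^2 + 2 * (g k)^2)"
    using assms unfolding l2_def by (intro summable_add summable_mult)
  have "(f k + g k)^2 \<le> 2 * (f k)^2 + 2 * (g k)^2" for k
    using zero_le_power2[of "f k - g k"] by (simp add: power2_sum power2_diff)
  then show "norm ((f k + g k)^2) \<le> 2 * (f k)^2 + 2 * (g k)^2" for k
    by simp
qed

lemma l2_minus: "l2 f \<Longrightarrow> l2 (\<lambda>k. - f k)"
  by (simp add: l2_def)

lemma l2_diff: "l2 f \<Longrightarrow> l2 g \<Longrightarrow> l2 (\<lambda>k. f k - g k)"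
  using l2_add[of f "\<lambda>k. - g k"] l2_minus[of g] by simp

lemma l2_abs: "l2 f \<Longrightarrow> l2 (\<lambda>k. \<bar>f k\<bar>)"
  by (simp add: l2_def)

lemma l2_zero: "l2 (\<lambda>k. 0)"
  by (simp add: l2_def)

lemma l2_sum: "(\<And>i. i \<in> I \<Longrightarrow> l2 (f i)) \<Longrightarrow> l2 (\<lambda>k. \<Sum>i\<in>I. f i k)"
  by (induction I rule: infinite_finite_induct) (auto intro: l2_add l2_zero)

lemma l2_mult_Bseq:
  assumes "Bseq f" "l2 g"
  shows "l2 (\<lambda>k. f k * g k)"
proof -
  from assms(1) obtain K where "K > 0" and K: "\<And>k. \<bar>f k\<bar> \<le> K"
    by (auto simp: Bseq_def)
  show ?thesis
  proof (rule l2_comparison[OF l2_cmult[OF assms(2), of K]])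
    fix k show "\<bar>f k * g k\<bar> \<le> \<bar>K * g k\<bar>"
      using K[of k] \<open>K > 0\<close> by (simp add: abs_mult mult_right_mono)
  qed
qed

text \<open>The update rules start at index 1, so most estimates come for the shifted
  sequence.\<close>

lemma l2_Suc_iff: "l2 (\<lambda>k. f (Suc k)) \<longleftrightarrow> l2 f"
  unfolding l2_def using summable_Suc_iff[of "\<lambda>k. (f k)^2"] .

lemma l2_Bseq:
  assumes "l2 f" shows "Bseq f"
proof -
  from assms have "Bseq (\<lambda>k. (f k)^2)"
    unfolding l2_def by (intro convergent_imp_Bseq) (auto simp: convergent_def dest: summable_LIMSEQ_zero)
  then obtain K where "K > 0" and K: "\<And>k. (f k)^2 \<le> K" by (auto simp: Bseq_def)
  show ?thesis
    by (rule BseqI'[of _ "sqrt K"]) (use K in \<open>simp add: real_le_rsqrt\<close>)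
qed

lemma Bseq_plus:
  fixes f g :: "nat \<Rightarrow> real"
  assumes "Bseq f" "Bseq g"
  shows "Bseq (\<lambda>k. f k + g k)"
proof -
  from assms obtain K L where "\<And>k. \<bar>f k\<bar> \<le> K" "\<And>k. \<bar>g k\<bar> \<le> L"
    by (auto simp: Bseq_def)
  then show ?thesis
    by (intro BseqI'[of _ "K + L"]) (simp add: order_trans[OF abs_triangle_ineq] add_mono)
qed

lemma Bseq_diff: "Bseq f \<Longrightarrow> Bseq g \<Longrightarrow> Bseq (\<lambda>k. f k - g k :: real)"
  using Bseq_plus[of f "\<lambda>k. - g k"] by (simp add: Bseq_minus_iff)

lemma l2_of_summable_bound:
  assumes "summable D" "c > 0" "\<And>k. c * (x k)^2 \<le> D k"
  shows "l2 x"
  unfolding l2_def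
proof (rule summable_comparison_test'[where N = 0])
  show "summable (\<lambda>k. inverse c * D k)" using assms(1) by (rule summable_mult)
  have "(x k)^2 \<le> inverse c * D k" for k
    using assms(2) assms(3)[of k] by (simp add: field_simps)
  then show "norm ((x k)^2) \<le> inverse c * D k" for k by simp
qed

lemma average_and_min_le_of_l2:
  fixes g :: "nat \<Rightarrow> real"
  assumes "l2 g"
  shows "\<exists>c>0. \<forall>k\<ge>1. (1 / real k) * (\<Sum>l=1..k. g l) \<le> c / sqrt (real k)
            \<and> Min (g ` {1..k}) \<le> c / sqrt (real k)"
proof -
  define S where "S = suminf (\<lambda>k. (g k)^2)"
  \<comment> \<open>Adding 1 keeps \<open>c\<close> positive even when \<open>g\<close> vanishes
    identically; \<open>S\<close> also counts index 0, which only enlarges it.\<close>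
  define c where "c = sqrt (S + 1)"
  have sm: "summable (\<lambda>k. (g k)^2)"
    using assms by (simp add: l2_def)
  have S0: "S \<ge> 0"
    unfolding S_def by (rule suminf_nonneg[OF sm]) simp
  have c0: "c > 0" and c2: "c^2 = S + 1"
    using S0 by (simp_all add: c_def)
  have avg: "(1 / real k) * (\<Sum>l=1..k. g l) \<le> c / sqrt (real k)" if "k \<ge> 1" for k
  proof -
    have "(\<Sum>l=1..k. g l)^2 \<le> (\<Sum>l=1..k. (g l)^2) * real (card {1..k})"
      by (rule sum_squared_le_sum_of_squares)
    also have "\<dots> \<le> c^2 * real (card {1..k})"
    proof (rule mult_right_mono)
      have "(\<Sum>l=1..k. (g l)^2) \<le> S"
        unfolding S_def by (rule sum_le_suminf[OF sm]) auto
      then show "(\<Sum>l=1..k. (g l)^2) \<le> c^2" by (simp add: c2)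
    qed simp
    also have "\<dots> = (c * sqrt (real k))^2" by (simp add: power_mult_distrib)
    finally have "(\<Sum>l=1..k. g l) \<le> c * sqrt (real k)"
      by (rule power2_le_imp_le) (use c0 in simp)
    then have "(\<Sum>l=1..k. g l) / real k \<le> c * sqrt (real k) / real k"
      by (rule divide_right_mono) simp
    also have "\<dots> = c / (real k / sqrt (real k))" by simp
    also have "\<dots> = c / sqrt (real k)" by (subst real_div_sqrt) auto
    finally show ?thesis by simp
  qed
  have min: "Min (g ` {1..k}) \<le> (1 / real k) * (\<Sum>l=1..k. g l)" if "k \<ge> 1" for k
  proof -
    have "real (card {1..k}) * Min (g ` {1..k}) \<le> (\<Sum>l=1..k. g l)"
      by (rule sum_bounded_below) simp
    then show ?thesis using that by (simp add: pos_le_divide_eq mult.commute)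
  qed
  show ?thesis
  proof (intro exI[of _ c] conjI allI impI)
    fix k :: nat assume k: "k \<ge> 1"
    show "(1 / real k) * (\<Sum>l=1..k. g l) \<le> c / sqrt (real k)" by (rule avg[OF k])
    show "Min (g ` {1..k}) \<le> c / sqrt (real k)" by (rule order_trans[OF min[OF k] avg[OF k]])
  qed (rule c0)
qed

subsection \<open>Real analytic functions\<close>

lemma real_analytic_has_derivatives:
  assumes "real_analytic f"
  shows "(f has_real_derivative deriv f x) (at x)"
    and "(deriv f has_real_derivative deriv (deriv f) x) (at x)"
proof -
  obtain r c where r: "r > 0" and c: "\<And>y. \<bar>y - x\<bar> < r \<Longrightarrow> (\<lambda>k. c k * (y - x)^k) sums f y"
    using assms unfolding real_analytic_def by blast
  have smc: "summable (\<lambda>k. c k * z^k)" if "norm z < r" for z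
    using c[of "x + z"] that by (simp add: sums_iff)
  have smd: "summable (\<lambda>k. diffs c k * z^k)" if "norm z < r" for z
    by (rule termdiff_converges[OF that smc])
  \<comment> \<open>Needed on the whole ball, not just at \<open>x\<close>: the second derivative at
    \<open>x\<close> requires \<open>deriv f\<close> to be a power series near
    \<open>x\<close>.\<close>
  have D1: "(f has_real_derivative (\<Sum>k. diffs c k * (y - x)^k)) (at y)" if "\<bar>y - x\<bar> < r" for y
  proof -
    have "((\<lambda>z. \<Sum>k. c k * z^k) has_real_derivative (\<Sum>k. diffs c k * (y - x)^k)) (at (y - x))"
      by (rule termdiffs_strong'[OF smc]) (use that in auto)
    then have "((\<lambda>y. \<Sum>k. c k * (y - x)^k) has_real_derivative (\<Sum>k. diffs c k * (y - x)^k)) (at y)"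
      using DERIV_shift[of "\<lambda>z. \<Sum>k. c k * z^k" _ y "- x"] by simp
    then show ?thesis
      by (rule has_field_derivative_transform_within_open[of _ _ _ "ball x r"])
         (use that c in \<open>auto simp: dist_real_def abs_minus_commute sums_iff\<close>)
  qed
  show "(f has_real_derivative deriv f x) (at x)"
    using DERIV_imp_deriv[OF D1[of x]] D1[of x] r by simp
  have "((\<lambda>z. \<Sum>k. diffs c k * z^k) has_real_derivative (\<Sum>k. diffs (diffs c) k * (x - x)^k)) (at (x - x))"
    by (rule termdiffs_strong'[OF smd]) (use r in auto)
  then have "((\<lambda>y. \<Sum>k. diffs c k * (y - x)^k) has_real_derivative (\<Sum>k. diffs (diffs c) k * (x - x)^k)) (at x)"
    using DERIV_shift[of "\<lambda>z. \<Sum>k. diffs c k * z^k" _ x "- x"] by simp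
  then have "(deriv f has_real_derivative (\<Sum>k. diffs (diffs c) k * (x - x)^k)) (at x)"
    by (rule has_field_derivative_transform_within_open[of _ _ _ "ball x r"])
       (use r D1 in \<open>auto simp: dist_real_def abs_minus_commute intro!: DERIV_imp_deriv[symmetric]\<close>)
  then show "(deriv f has_real_derivative deriv (deriv f) x) (at x)"
    using DERIV_imp_deriv by metis
qed

lemma lipschitz_of_deriv_bound:
  fixes f :: "real \<Rightarrow> real"
  assumes "\<And>x. (f has_real_derivative f' x) (at x)" and "\<And>x. \<bar>f' x\<bar> \<le> B"
  shows "\<bar>f x - f y\<bar> \<le> B * \<bar>x - y\<bar>"
  using field_differentiable_bound[of UNIV f f' B x y] assms by simp

subsection \<open>One sweep of the algorithm\<close>

locale admm =
  fixes N d q n :: nat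
    and X Y :: mat
    and lam mu psi0 psi1 psi2 :: real
    and beta :: "nat \<Rightarrow> real"
    and sig :: "nat \<Rightarrow> real \<Rightarrow> real"
    and Vmax epsh eps :: "nat \<Rightarrow> real"
    and om :: "nat \<Rightarrow> nat \<Rightarrow> real"
    and W U V Lm :: "nat \<Rightarrow> nat \<Rightarrow> mat"
  assumes N3: "N \<ge> 3"
    and lam_pos: "lam > 0" and mu_pos: "mu > 0"
    and beta_pos: "\<And>i. 1 \<le> i \<Longrightarrow> i \<le> N \<Longrightarrow> beta i > 0"
    and psi_pos: "psi1 > 0"
    and sig_an: "\<And>i. 1 \<le> i \<Longrightarrow> i \<le> N - 1 \<Longrightarrow> real_analytic (sig i)"
    and sig_b0: "\<And>i x. 1 \<le> i \<Longrightarrow> i \<le> N - 1 \<Longrightarrow> \<bar>sig i x\<bar> \<le> psi0"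
    and sig_b1: "\<And>i x. 1 \<le> i \<Longrightarrow> i \<le> N - 1 \<Longrightarrow> \<bar>deriv (sig i) x\<bar> \<le> psi1"
    and sig_b2: "\<And>i x. 1 \<le> i \<Longrightarrow> i \<le> N - 1 \<Longrightarrow> \<bar>deriv (deriv (sig i)) x\<bar> \<le> psi2"
    and step_W: "\<And>k i. k \<ge> 1 \<Longrightarrow> 1 \<le> i \<Longrightarrow> i \<le> N - 1 \<Longrightarrow>
        is_arg_min (\<lambda>Wi. lam / 2 * fsq d d Wi + beta i / 2 * fsq d n
            (\<lambda>a b. mmul d Wi (Vz X (V (k-1)) (i-1)) a b - U (k-1) i a b + Lm (k-1) i a b / beta i))
          (\<lambda>_. True) (W k i)"
    and step_WN: "\<And>k. k \<ge> 1 \<Longrightarrow>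
        is_arg_min (\<lambda>Wi. lam / 2 * fsq q d Wi + beta N / 2 * fsq q n
            (\<lambda>a b. mmul d Wi (V (k-1) (N-1)) a b - V (k-1) N a b + Lm (k-1) N a b / beta N))
          (\<lambda>_. True) (W k N)"
    and step_U: "\<And>k i. k \<ge> 1 \<Longrightarrow> 1 \<le> i \<Longrightarrow> i \<le> N - 1 \<Longrightarrow>
        is_arg_min (\<lambda>Ui. mu / 2 * fsq d n (\<lambda>a b. Vz X (V k) (i-1) a b + sig i (Ui a b) - V (k-1) i a b)
            + beta i / 2 * fsq d n (\<lambda>a b. Ui a b - mmul d (W k i) (Vz X (V k) (i-1)) a b - Lm (k-1) i a b / beta i)
            + om (k-1) i / 2 * fsq d n (\<lambda>a b. Ui a b - U (k-1) i a b))
          (\<lambda>_. True) (U k i)"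
    and step_V: "\<And>k i. k \<ge> 1 \<Longrightarrow> 1 \<le> i \<Longrightarrow> i \<le> N - 2 \<Longrightarrow>
        is_arg_min (\<lambda>Vi. mu / 2 * fsq d n (\<lambda>a b. Vz X (V k) (i-1) a b + sig i (U k i a b) - Vi a b)
            + mu / 2 * fsq d n (\<lambda>a b. Vi a b + sig (i+1) (U (k-1) (i+1) a b) - V (k-1) (i+1) a b)
            + beta (i+1) / 2 * fsq d n (\<lambda>a b. mmul d (W k (i+1)) Vi a b - U (k-1) (i+1) a b
                                              + Lm (k-1) (i+1) a b / beta (i+1)))
          (\<lambda>_. True) (V k i)"
    and step_VN1: "\<And>k. k \<ge> 1 \<Longrightarrow>
        is_arg_min (\<lambda>Vi. mu / 2 * fsq d n (\<lambda>a b. Vi a b - Vz X (V k) (N-2) a b - sig (N-1) (U k (N-1) a b))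
            + beta N / 2 * fsq q n (\<lambda>a b. mmul d (W k N) Vi a b - V (k-1) N a b + Lm (k-1) N a b / beta N))
          (\<lambda>_. True) (V k (N-1))"
    and step_VN: "\<And>k. k \<ge> 1 \<Longrightarrow> meq q n (V k N)
        (\<lambda>a b. (Y a b + beta N * mmul d (W k N) (V k (N-1)) a b + Lm (k-1) N a b) / (1 + beta N))"
    and step_L: "\<And>k i. k \<ge> 1 \<Longrightarrow> 1 \<le> i \<Longrightarrow> i \<le> N - 1 \<Longrightarrow> meq d n (Lm k i)
        (\<lambda>a b. Lm (k-1) i a b + beta i * (mmul d (W k i) (Vz X (V k) (i-1)) a b - U k i a b))"
    and step_LN: "\<And>k. k \<ge> 1 \<Longrightarrow> meq q n (Lm k N)
        (\<lambda>a b. Lm (k-1) N a b + beta N * (mmul d (W k N) (V k (N-1)) a b - V k N a b))"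
    and Vmax0: "Vmax 0 > frob d n X"
    and A1: "\<And>i. 1 \<le> i \<Longrightarrow> i \<le> N - 1 \<Longrightarrow>
        beta i > max (32 * (1 + sqrt 2) * mu * acoef psi0 psi1 psi2 Vmax i) (16 * mu * psi1^2)"
    and A1N: "beta N > 1"
    and A2_eh: "\<And>i. 1 \<le> i \<Longrightarrow> i \<le> N - 1 \<Longrightarrow>
        0 < epsh i \<and> epsh i < sqrt (Delta mu (beta i) (acoef psi0 psi1 psi2 Vmax i)) / 32"
    and A2_e: "\<And>i. 1 \<le> i \<Longrightarrow> i \<le> N - 1 \<Longrightarrow>
        0 < eps i \<and> eps i < omin mu (beta i) (acoef psi0 psi1 psi2 Vmax i) (epsh i) / 4"
    and A2_om: "\<And>k i. 1 \<le> i \<Longrightarrow> i \<le> N - 1 \<Longrightarrow>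
        omin mu (beta i) (acoef psi0 psi1 psi2 Vmax i) (epsh i) < om k i
        \<and> om k i \<le> om (Suc k) i
        \<and> om (Suc k) i < omax mu (beta i) (acoef psi0 psi1 psi2 Vmax i) (epsh i) (eps i)"
    and A3: "\<And>k i. 1 \<le> i \<Longrightarrow> i \<le> N - 1 \<Longrightarrow> frob d n (V k i) \<le> Vmax i"
begin

text \<open>\<open>v k i\<close> is $V_i^k$ with the convention $V_0 = X$; with \<open>Z\<close>, the blocks $U_1,\dots,U_{N-1},V_N$ that
  the linear constraints $W_i V_{i-1} = Z_i$ produce, the output layer needs no separate treatment.\<close>

definition v :: "nat \<Rightarrow> nat \<Rightarrow> mat" where "v k i = Vz X (V k) i"
definition Z :: "nat \<Rightarrow> nat \<Rightarrow> mat" where "Z k i = (if i = N then V k N else U k i)"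
definition R :: "nat \<Rightarrow> nat \<Rightarrow> mat" where
  "R k i = (\<lambda>a b. mmul d (W k i) (v k (i-1)) a b - Z k i a b)"
abbreviation rows :: "nat \<Rightarrow> nat" where "rows i \<equiv> rw N d q i"

text \<open>\<open>h\<close> and \<open>p\<close> take the blocks as separate arguments because a
  sweep passes through states in which some blocks are new and others still old. \<open>h\<close> is
  the constraint term of a layer after completing the square.\<close>

definition h :: "nat \<Rightarrow> mat \<Rightarrow> mat \<Rightarrow> mat \<Rightarrow> mat \<Rightarrow> real" where
  "h i W' V' Z' L' = beta i / 2 * fsq (rows i) n (\<lambda>a b. mmul d W' V' a b - Z' a b + L' a b / beta i)"
definition p :: "nat \<Rightarrow> mat \<Rightarrow> mat \<Rightarrow> mat \<Rightarrow> real" where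
  "p i A U' B = mu / 2 * fsq d n (\<lambda>a b. A a b + sig i (U' a b) - B a b)"
definition Lk :: "nat \<Rightarrow> real" where
  "Lk k = Lag N d q n X Y lam mu beta sig (W k) (U k) (V k) (Lm k)"

lemma v_simps [simp]: "v k 0 = X" "i > 0 \<Longrightarrow> v k i = V k i"
  by (simp_all add: v_def Vz_def)

lemma Z_simps [simp]: "Z k N = V k N" "i \<noteq> N \<Longrightarrow> Z k i = U k i"
  by (simp_all add: Z_def)

lemma rows_simps [simp]: "rows N = q" "i \<noteq> N \<Longrightarrow> rows i = d"
  by (simp_all add: rw_def)

lemma Lag_sum_split:
  "Lag N d q n X Y lam mu beta sig W' U' V' L'
    = fsq q n (\<lambda>a b. V' N a b - Y a b) / 2
      + (\<Sum>i=1..N. lam / 2 * fsq (rows i) d (W' i)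
            + (minner (rows i) n (L' i) (\<lambda>a b. mmul d (W' i) (Vz X V' (i-1)) a b - (if i = N then V' else U') i a b)
               + beta i / 2 * fsq (rows i) n (\<lambda>a b. mmul d (W' i) (Vz X V' (i-1)) a b - (if i = N then V' else U') i a b)))
      + mu / 2 * (\<Sum>i=1..N-1. fsq d n (\<lambda>a b. Vz X V' (i-1) a b + sig i (U' i a b) - V' i a b))"
proof -
  define f where "f i = minner (rows i) n (L' i) (\<lambda>a b. mmul d (W' i) (Vz X V' (i-1)) a b - (if i = N then V' else U') i a b)
      + beta i / 2 * fsq (rows i) n (\<lambda>a b. mmul d (W' i) (Vz X V' (i-1)) a b - (if i = N then V' else U') i a b)" for i
  have "(\<Sum>i=1..N. f i) = (\<Sum>i=1..N-1. f i) + f N"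
    using N3 sum.cl_ivl_Suc[of f 1 "N-1"] by simp
  also have "(\<Sum>i=1..N-1. f i) = (\<Sum>i=1..N-1.
        minner d n (L' i) (\<lambda>a b. mmul d (W' i) (Vz X V' (i-1)) a b - U' i a b)
      + beta i / 2 * fsq d n (\<lambda>a b. mmul d (W' i) (Vz X V' (i-1)) a b - U' i a b))"
    by (rule sum.cong) (use N3 in \<open>auto simp: f_def\<close>)
  finally have "(\<Sum>i=1..N. f i) = \<dots> + f N" .
  then show ?thesis
    unfolding Lag_def sum.distrib[of "\<lambda>i. lam / 2 * fsq (rows i) d (W' i)"] f_def[symmetric]
    by (simp add: f_def sum_distrib_left)
qed

lemma Lk_eq:
  "Lk k = fsq q n (\<lambda>a b. V k N a b - Y a b) / 2
     + (\<Sum>i=1..N. lam / 2 * fsq (rows i) d (W k i) + h i (W k i) (v k (i-1)) (Z k i) (Lm k i)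
                   - fsq (rows i) n (Lm k i) / (2 * beta i))
     + (\<Sum>i=1..N-1. p i (v k (i-1)) (U k i) (V k i))"
proof -
  have "h i (W k i) (v k (i-1)) (Z k i) (Lm k i) - fsq (rows i) n (Lm k i) / (2 * beta i)
      = minner (rows i) n (Lm k i) (\<lambda>a b. mmul d (W k i) (v k (i-1)) a b - Z k i a b)
        + beta i / 2 * fsq (rows i) n (\<lambda>a b. mmul d (W k i) (v k (i-1)) a b - Z k i a b)"
    if "i \<in> {1..N}" for i
    unfolding h_def using beta_pos[of i] that
    by (subst complete_square) auto
  then have "(\<Sum>i=1..N. lam / 2 * fsq (rows i) d (W k i)
         + (h i (W k i) (v k (i-1)) (Z k i) (Lm k i) - fsq (rows i) n (Lm k i) / (2 * beta i)))
     = (\<Sum>i=1..N. lam / 2 * fsq (rows i) d (W k i)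
            + (minner (rows i) n (Lm k i) (\<lambda>a b. mmul d (W k i) (Vz X (V k) (i-1)) a b - (if i = N then V k else U k) i a b)
               + beta i / 2 * fsq (rows i) n (\<lambda>a b. mmul d (W k i) (Vz X (V k) (i-1)) a b - (if i = N then V k else U k) i a b)))"
    by (intro sum.cong) (simp_all add: v_def Z_def if_distrib[of "\<lambda>f. f _"] cong: if_cong)
  then show ?thesis
    unfolding Lk_def Lag_sum_split
    by (simp add: p_def v_def sum_distrib_left add_diff_eq)
qed

subsection \<open>Block updates\<close>

lemma W_arg_min:
  assumes "1 \<le> i" "i \<le> N"
  shows "is_arg_min (\<lambda>W'. lam / 2 * fsq (rows i) d W' + h i W' (v k (i-1)) (Z k i) (Lm k i))
           (\<lambda>_. True) (W (Suc k) i)"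
proof (cases "i = N")
  case True
  then show ?thesis using step_WN[of "Suc k"] N3 by (simp add: h_def)
next
  case False
  then show ?thesis using step_W[of "Suc k" i] assms by (simp add: h_def v_def)
qed

lemma W_expand:
  "lam / 2 * fsq (rows i) d (\<lambda>a b. M a b + t * D a b) + h i (\<lambda>a b. M a b + t * D a b) V' Z' L'
   = (lam / 2 * fsq (rows i) d M + h i M V' Z' L')
     + t * (lam * minner (rows i) d M D
            + beta i * minner (rows i) n (\<lambda>a b. mmul d M V' a b - Z' a b + L' a b / beta i) (mmul d D V'))
     + t^2 * (lam / 2 * fsq (rows i) d D + beta i / 2 * fsq (rows i) n (mmul d D V'))"
proof -
  have "h i (\<lambda>a b. M a b + t * D a b) V' Z' L'
    = beta i / 2 * fsq (rows i) n (\<lambda>a b. (mmul d M V' a b - Z' a b + L' a b / beta i) + t * mmul d D V' a b)"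
    unfolding h_def mmul_add_scaled_left by (simp add: algebra_simps)
  then show ?thesis
    unfolding fsq_add_scaled h_def by (simp add: algebra_simps)
qed

lemma W_descent:
  assumes "1 \<le> i" "i \<le> N"
  shows "lam / 2 * fsq (rows i) d (W (Suc k) i) + h i (W (Suc k) i) (v k (i-1)) (Z k i) (Lm k i)
    \<le> lam / 2 * fsq (rows i) d (W k i) + h i (W k i) (v k (i-1)) (Z k i) (Lm k i)"
  using W_arg_min[OF assms, of k] unfolding is_arg_min_linorder by blast

text \<open>The condition pairs the new W with the old V, \<open>Z\<close> and multiplier; this
  mismatch with the gradient at the new point is what \<open>grad_W_l2\<close> has to
  estimate.\<close>

lemma W_stationary:
  assumes "1 \<le> i" "i \<le> N" "a < rows i" "b < d"
  shows "lam * W (Suc k) i a b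
     + (\<Sum>y<n. (Lm k i a y + beta i * (mmul d (W (Suc k) i) (v k (i-1)) a y - Z k i a y)) * v k (i-1) b y) = 0"
proof -
  note * = quadratic_along_arg_min[OF W_arg_min[OF assms(1,2), of k] W_expand, of "munit a b"]
  have "beta i * (\<Sum>y<n. (mmul d (W (Suc k) i) (v k (i-1)) a y - Z k i a y + Lm k i a y / beta i) * v k (i-1) b y)
     = (\<Sum>y<n. (Lm k i a y + beta i * (mmul d (W (Suc k) i) (v k (i-1)) a y - Z k i a y)) * v k (i-1) b y)"
    unfolding sum_distrib_left
    using beta_pos[OF assms(1,2)] by (intro sum.cong) (auto simp: field_simps)
  with * show ?thesis
    using assms by (simp add: minner_munit minner_mmul_munit_left)
qed

text \<open>The last hidden layer has no successor residual, so its coefficient is set to zero.\<close>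

definition mu_next :: "nat \<Rightarrow> real" where "mu_next i = (if Suc i = N then 0 else mu)"

text \<open>The subproblems for \<open>i \<le> N - 2\<close> and \<open>i = N - 1\<close> take one
  form: \<open>Z\<close> selects \<open>U\<close> or \<open>V N\<close> as the target of the next
  layer, and \<open>mu_next\<close> removes the absent residual.\<close>

lemma V_arg_min:
  assumes "1 \<le> i" "i \<le> N - 1"
  shows "is_arg_min (\<lambda>V'. mu / 2 * fsq d n (\<lambda>a b. V' a b - (v (Suc k) (i-1) a b + sig i (U (Suc k) i a b)))
      + mu_next i / 2 * fsq d n (\<lambda>a b. V' a b + sig (Suc i) (U k (Suc i) a b) - V k (Suc i) a b)
      + h (Suc i) (W (Suc k) (Suc i)) V' (Z k (Suc i)) (Lm k (Suc i)))
           (\<lambda>_. True) (V (Suc k) i)"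
proof (cases "Suc i = N")
  case True
  then have "i = N - 1" "N - Suc (Suc 0) = i - 1" by auto
  with True show ?thesis
    using step_VN1[of "Suc k"] N3 by (simp add: h_def v_def mu_next_def diff_diff_eq numeral_2_eq_2)
next
  case False
  then have "i \<le> N - 2" using assms by simp
  with False assms show ?thesis
    using step_V[of "Suc k" i]
    by (subst fsq_minus_commute) (simp add: h_def v_def mu_next_def)
qed

lemma V_expand:
  "mu / 2 * fsq d n (\<lambda>a b. (M a b + t * D a b) - A a b)
      + m' / 2 * fsq d n (\<lambda>a b. (M a b + t * D a b) + B a b - C a b)
      + h j W' (\<lambda>a b. M a b + t * D a b) Z' L'
   = (mu / 2 * fsq d n (\<lambda>a b. M a b - A a b)
      + m' / 2 * fsq d n (\<lambda>a b. M a b + B a b - C a b) + h j W' M Z' L')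
     + t * (mu * minner d n (\<lambda>a b. M a b - A a b) D + m' * minner d n (\<lambda>a b. M a b + B a b - C a b) D
            + beta j * minner (rows j) n (\<lambda>a b. mmul d W' M a b - Z' a b + L' a b / beta j) (mmul d W' D))
     + t^2 * (mu / 2 * fsq d n D + m' / 2 * fsq d n D + beta j / 2 * fsq (rows j) n (mmul d W' D))"
proof -
  have 1: "h j W' (\<lambda>a b. M a b + t * D a b) Z' L'
    = beta j / 2 * fsq (rows j) n (\<lambda>a b. (mmul d W' M a b - Z' a b + L' a b / beta j) + t * mmul d W' D a b)"
    unfolding h_def mmul_add_scaled_right by (simp add: algebra_simps)
  have 2: "(\<lambda>a b. (M a b + t * D a b) - A a b) = (\<lambda>a b. (M a b - A a b) + t * D a b)"
    and 3: "(\<lambda>a b. (M a b + t * D a b) + B a b - C a b) = (\<lambda>a b. (M a b + B a b - C a b) + t * D a b)"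
    by (simp_all add: algebra_simps)
  show ?thesis
    unfolding 1 2 3 fsq_add_scaled unfolding h_def by (simp add: algebra_simps)
qed

text \<open>The first residual makes the subproblem strongly convex with modulus \<open>mu\<close>.
  Of the exact second-order growth only this part, \<open>mu / 2\<close> times the squared change,
  is kept; the other parts are nonnegative.\<close>

lemma V_descent:
  assumes "1 \<le> i" "i \<le> N - 1"
  shows "p i (v (Suc k) (i-1)) (U (Suc k) i) (V (Suc k) i)
      + (if Suc i = N then 0 else p (Suc i) (V (Suc k) i) (U k (Suc i)) (V k (Suc i)))
      + h (Suc i) (W (Suc k) (Suc i)) (V (Suc k) i) (Z k (Suc i)) (Lm k (Suc i))
      + mu / 2 * fsq d n (\<lambda>a b. V k i a b - V (Suc k) i a b)
    \<le> p i (v (Suc k) (i-1)) (U (Suc k) i) (V k i)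
      + (if Suc i = N then 0 else p (Suc i) (V k i) (U k (Suc i)) (V k (Suc i)))
      + h (Suc i) (W (Suc k) (Suc i)) (V k i) (Z k (Suc i)) (Lm k (Suc i))"
proof -
  have eq: "mu / 2 * fsq d n (\<lambda>a b. V' a b - (v (Suc k) (i-1) a b + sig i (U (Suc k) i a b)))
      + mu_next i / 2 * fsq d n (\<lambda>a b. V' a b + sig (Suc i) (U k (Suc i) a b) - V k (Suc i) a b)
      = p i (v (Suc k) (i-1)) (U (Suc k) i) V' + (if Suc i = N then 0 else p (Suc i) V' (U k (Suc i)) (V k (Suc i)))"
    for V' by (simp add: p_def mu_next_def fsq_minus_commute[of _ _ V'])
  have "mu_next i \<ge> 0" "beta (Suc i) > 0"
    using mu_pos beta_pos[of "Suc i"] assms N3 by (auto simp: mu_next_def)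
  then show ?thesis
    using quadratic_growth_arg_min[OF V_arg_min[OF assms, of k] V_expand, of "V k i"]
    unfolding eq by simp
qed

lemma V_stationary:
  assumes "1 \<le> i" "i \<le> N - 1" "a < d" "b < n"
  shows "- mu * (v (Suc k) (i-1) a b + sig i (U (Suc k) i a b) - V (Suc k) i a b)
    + mu_next i * (V (Suc k) i a b + sig (Suc i) (U k (Suc i) a b) - V k (Suc i) a b)
    + (\<Sum>x<rows (Suc i). (Lm k (Suc i) x b
        + beta (Suc i) * (mmul d (W (Suc k) (Suc i)) (V (Suc k) i) x b - Z k (Suc i) x b)) * W (Suc k) (Suc i) x a) = 0"
proof -
  note * = quadratic_along_arg_min[OF V_arg_min[OF assms(1,2), of k] V_expand, of "munit a b"]
  have "Suc i \<le> N" using assms N3 by linarith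
  then have "beta (Suc i) \<noteq> 0" using beta_pos[of "Suc i"] by simp
  have "beta (Suc i) * (\<Sum>x<rows (Suc i). (mmul d (W (Suc k) (Suc i)) (V (Suc k) i) x b - Z k (Suc i) x b
          + Lm k (Suc i) x b / beta (Suc i)) * W (Suc k) (Suc i) x a)
     = (\<Sum>x<rows (Suc i). (Lm k (Suc i) x b
        + beta (Suc i) * (mmul d (W (Suc k) (Suc i)) (V (Suc k) i) x b - Z k (Suc i) x b)) * W (Suc k) (Suc i) x a)"
    unfolding sum_distrib_left
    using \<open>beta (Suc i) \<noteq> 0\<close> by (intro sum.cong) (auto simp: field_simps)
  with * show ?thesis
    using assms by (simp add: minner_munit minner_mmul_munit_right algebra_simps)
qed

section \<open>The U-subproblem and the multipliers of the hidden layers\<close>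

lemma sig_derivs:
  assumes "1 \<le> i" "i \<le> N - 1"
  shows "(sig i has_real_derivative deriv (sig i) x) (at x)"
    and "(deriv (sig i) has_real_derivative deriv (deriv (sig i)) x) (at x)"
  using real_analytic_has_derivatives[OF sig_an[OF assms]] .

lemma U_arg_min:
  assumes "1 \<le> i" "i \<le> N - 1"
  shows "is_arg_min (\<lambda>U'. p i (v (Suc k) (i-1)) U' (V k i) + h i (W (Suc k) i) (v (Suc k) (i-1)) U' (Lm k i)
      + om k i / 2 * fsq d n (\<lambda>a b. U' a b - U k i a b)) (\<lambda>_. True) (U (Suc k) i)"
proof -
  have "fsq d n (\<lambda>a b. U' a b - A a b - B a b) = fsq d n (\<lambda>a b. A a b - U' a b + B a b)" for U' A B
    using fsq_minus_commute[of d n U' "\<lambda>a b. A a b + B a b"] by (simp add: algebra_simps)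
  with assms show ?thesis
    using step_U[of "Suc k" i] by (simp add: p_def h_def v_def)
qed

text \<open>No convexity in U is available, so the minimiser is only compared with the previous
  iterate, at which the proximal term vanishes.\<close>

lemma U_descent:
  assumes "1 \<le> i" "i \<le> N - 1"
  shows "p i (v (Suc k) (i-1)) (U (Suc k) i) (V k i) + h i (W (Suc k) i) (v (Suc k) (i-1)) (U (Suc k) i) (Lm k i)
      + om k i / 2 * fsq d n (\<lambda>a b. U (Suc k) i a b - U k i a b)
    \<le> p i (v (Suc k) (i-1)) (U k i) (V k i) + h i (W (Suc k) i) (v (Suc k) (i-1)) (U k i) (Lm k i)"
proof -
  have "fsq d n (\<lambda>a b. 0) = 0" by (simp add: fsq_def)
  then show ?thesis
    using U_arg_min[OF assms, of k, unfolded is_arg_min_linorder, THEN conjunct2, rule_format, OF TrueI, of "U k i"] by simp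
qed

lemma Lm_update:
  assumes "1 \<le> i" "i \<le> N" "a < rows i" "b < n"
  shows "Lm (Suc k) i a b = Lm k i a b + beta i * R (Suc k) i a b"
proof (cases "i = N")
  case True
  then show ?thesis using step_LN[of "Suc k"] assms N3 by (simp add: meq_def R_def)
next
  case False
  then show ?thesis using step_L[of "Suc k" i] assms by (simp add: meq_def R_def v_def)
qed

text \<open>Stationarity of the U-subproblem in the entry \<open>(a, b)\<close> says that
  \<open>mu * P * sig' - beta * Q\<close>, plus \<open>om\<close> times the change of U, is 0, and
  the multiplier step makes \<open>beta * Q\<close> exactly the new multiplier. The residual
  \<open>P\<close> contains the old \<open>V k i\<close> because U precedes V within a layer; this
  is why two sweeps interact later.\<close>

lemma Lm_hidden:
  assumes "1 \<le> i" "i \<le> N - 1" "a < d" "b < n"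
  shows "Lm (Suc k) i a b = mu * (v (Suc k) (i-1) a b + sig i (U (Suc k) i a b) - V k i a b) * deriv (sig i) (U (Suc k) i a b)
           + om k i * (U (Suc k) i a b - U k i a b)"
proof -
  define f where "f t = (\<lambda>x y. U (Suc k) i x y + t * munit a b x y)" for t
  define P where "P = (\<lambda>x y. v (Suc k) (i-1) x y + sig i (U (Suc k) i x y) - V k i x y)"
  define Q where "Q = (\<lambda>x y. mmul d (W (Suc k) i) (v (Suc k) (i-1)) x y - U (Suc k) i x y + Lm k i x y / beta i)"
  define F where "F t = p i (v (Suc k) (i-1)) (f t) (V k i) + h i (W (Suc k) i) (v (Suc k) (i-1)) (f t) (Lm k i)
      + om k i / 2 * fsq d n (\<lambda>x y. f t x y - U k i x y)" for t
  have f0: "f 0 = U (Suc k) i" by (simp add: f_def)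
  have fd: "((\<lambda>t. f t x y) has_real_derivative munit a b x y) (at 0)" for x y
    unfolding f_def by (auto intro!: derivative_eq_intros)
  have sd: "((\<lambda>t. sig i (f t x y)) has_real_derivative deriv (sig i) (U (Suc k) i x y) * munit a b x y) (at 0)" for x y
    using DERIV_chain2[OF sig_derivs(1)[OF assms(1,2)] fd[of x y]] by (simp add: f0)
  have "i \<noteq> N" "i \<le> N" using assms N3 by linarith+
  then have iN: "rows i = d" by simp
  have Pd: "((\<lambda>t. p i (v (Suc k) (i-1)) (f t) (V k i)) has_real_derivative
       mu / 2 * (2 * minner d n P (\<lambda>x y. deriv (sig i) (U (Suc k) i x y) * munit a b x y))) (at 0)"
    unfolding p_def P_def f0[symmetric]
    by (intro DERIV_cmult fsq_has_derivative) (auto intro!: derivative_eq_intros sd simp: f0)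
  have Qd: "((\<lambda>t. h i (W (Suc k) i) (v (Suc k) (i-1)) (f t) (Lm k i)) has_real_derivative
       beta i / 2 * (2 * minner d n Q (\<lambda>x y. - munit a b x y))) (at 0)"
    unfolding h_def Q_def iN f0[symmetric]
    by (intro DERIV_cmult fsq_has_derivative) (auto intro!: derivative_eq_intros fd)
  have Ud: "((\<lambda>t. om k i / 2 * fsq d n (\<lambda>x y. f t x y - U k i x y)) has_real_derivative
       om k i / 2 * (2 * minner d n (\<lambda>x y. U (Suc k) i x y - U k i x y) (munit a b))) (at 0)"
    unfolding f0[symmetric]
    by (intro DERIV_cmult fsq_has_derivative) (auto intro!: derivative_eq_intros fd)
  define G where "G = mu / 2 * (2 * minner d n P (\<lambda>x y. deriv (sig i) (U (Suc k) i x y) * munit a b x y))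
       + beta i / 2 * (2 * minner d n Q (\<lambda>x y. - munit a b x y))
       + om k i / 2 * (2 * minner d n (\<lambda>x y. U (Suc k) i x y - U k i x y) (munit a b))"
  have "(F has_real_derivative G) (at 0)"
    unfolding F_def G_def by (intro DERIV_add Pd Qd Ud)
  moreover have "\<forall>t. \<bar>0 - t\<bar> < 1 \<longrightarrow> F 0 \<le> F t"
    using U_arg_min[OF assms(1,2), of k] unfolding is_arg_min_linorder F_def f0 by blast
  ultimately have "G = 0" by (rule DERIV_local_min[OF _ zero_less_one])
  moreover have "minner d n P (\<lambda>x y. deriv (sig i) (U (Suc k) i x y) * munit a b x y)
     = minner d n (\<lambda>x y. P x y * deriv (sig i) (U (Suc k) i x y)) (munit a b)"
    by (simp add: minner_def mult.assoc)
  moreover have "minner d n Q (\<lambda>x y. - munit a b x y) = - Q a b"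
    using minner_scale_right[of d n Q "-1" "munit a b"] minner_munit[OF assms(3,4), of Q] by simp
  ultimately have "mu * (P a b * deriv (sig i) (U (Suc k) i a b)) - beta i * Q a b
       + om k i * (U (Suc k) i a b - U k i a b) = 0"
    by (simp add: G_def minner_munit[OF assms(3,4)] field_simps)
  moreover have "beta i * Q a b = Lm (Suc k) i a b"
    using Lm_update[of i a b k] beta_pos[of i] assms iN \<open>i \<noteq> N\<close> \<open>i \<le> N\<close>
    by (simp add: Q_def R_def algebra_simps)
  ultimately show ?thesis by (simp add: P_def)
qed

section \<open>The output layer and the multiplier step\<close>

lemma VN_update:
  assumes "a < q" "b < n"
  shows "(1 + beta N) * V (Suc k) N a b = Y a b + beta N * mmul d (W (Suc k) N) (v (Suc k) (N-1)) a b + Lm k N a b"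
  using step_VN[of "Suc k"] assms A1N N3 by (simp add: meq_def)

text \<open>Same mechanism as in the hidden layers: the closed form for \<open>V N\<close> is the
  stationarity condition of the output block, and the multiplier step removes the penalty from
  it.\<close>

lemma Lm_output:
  assumes "a < q" "b < n"
  shows "Lm (Suc k) N a b = V (Suc k) N a b - Y a b"
  using VN_update[OF assms, of k] Lm_update[of N a b k] assms N3
  by (simp add: R_def algebra_simps)

lemma VN_descent:
  "fsq q n (\<lambda>a b. V (Suc k) N a b - Y a b) / 2 + h N (W (Suc k) N) (v (Suc k) (N-1)) (V (Suc k) N) (Lm k N)
     + (1 + beta N) / 2 * fsq q n (\<lambda>a b. V (Suc k) N a b - V k N a b)
   = fsq q n (\<lambda>a b. V k N a b - Y a b) / 2 + h N (W (Suc k) N) (v (Suc k) (N-1)) (V k N) (Lm k N)"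
proof -
  have "1 / 2 * (x' - y)^2 + bet / 2 * (m - x' + l / bet)^2 + (1 + bet) / 2 * (x' - x)^2
      = 1 / 2 * (x - y)^2 + bet / 2 * (m - x + l / bet)^2"
    if "bet > 0" and "(1 + bet) * x' = y + bet * m + l" for x' x y m l bet :: real
  proof -
    have l: "l = (1 + bet) * x' - y - bet * m" using that by simp
    show ?thesis using that(1) unfolding l by (simp add: field_simps power2_eq_square)
  qed
  note id = this[OF _ VN_update]
  have "1 / 2 * fsq q n (\<lambda>a b. V (Suc k) N a b - Y a b) + h N (W (Suc k) N) (v (Suc k) (N-1)) (V (Suc k) N) (Lm k N)
     + (1 + beta N) / 2 * fsq q n (\<lambda>a b. V (Suc k) N a b - V k N a b)
   = 1 / 2 * fsq q n (\<lambda>a b. V k N a b - Y a b) + h N (W (Suc k) N) (v (Suc k) (N-1)) (V k N) (Lm k N)"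
    unfolding h_def rows_simps fsq_def sum_distrib_left sum.distrib[symmetric]
    using A1N by (intro sum.cong refl id) auto
  then show ?thesis by simp
qed

text \<open>The multiplier moves by \<open>beta * R\<close>, so pairing its change with the residual
  \<open>R\<close> gives the squared change divided by \<open>beta\<close>. This is the only step of
  a sweep that can raise the Lagrangian.\<close>

lemma Lm_ascent:
  assumes "1 \<le> i" "i \<le> N"
  shows "h i (W (Suc k) i) (v (Suc k) (i-1)) (Z (Suc k) i) (Lm (Suc k) i) - fsq (rows i) n (Lm (Suc k) i) / (2 * beta i)
    = h i (W (Suc k) i) (v (Suc k) (i-1)) (Z (Suc k) i) (Lm k i) - fsq (rows i) n (Lm k i) / (2 * beta i)
      + fsq (rows i) n (\<lambda>a b. Lm (Suc k) i a b - Lm k i a b) / beta i"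
proof -
  have b: "beta i \<noteq> 0" using beta_pos[OF assms] by simp
  have "minner (rows i) n (Lm (Suc k) i) (R (Suc k) i)
     = minner (rows i) n (Lm k i) (R (Suc k) i) + fsq (rows i) n (\<lambda>a b. Lm (Suc k) i a b - Lm k i a b) / beta i"
    unfolding minner_def fsq_def sum_divide_distrib sum.distrib[symmetric]
    using b by (intro sum.cong refl) (simp add: Lm_update[OF assms] field_simps power2_eq_square)
  then show ?thesis
    unfolding h_def complete_square[OF b] by (simp add: R_def)
qed

text \<open>Changing \<open>V_i\<close> affects the terms of layers \<open>i\<close> and
  \<open>i + 1\<close>, so a layer cannot be balanced on its own; the per-layer inequalities are set
  up so that what crosses a layer boundary cancels in the sum.\<close>

lemma Lag_descent:
  "Lk (Suc k) + (\<Sum>i=1..N-1. om k i / 2 * fsq d n (\<lambda>a b. U (Suc k) i a b - U k i a b)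
                  + mu / 2 * fsq d n (\<lambda>a b. V (Suc k) i a b - V k i a b))
     + (1 + beta N) / 2 * fsq q n (\<lambda>a b. V (Suc k) N a b - V k N a b)
   \<le> Lk k + (\<Sum>i=1..N. fsq (rows i) n (\<lambda>a b. Lm (Suc k) i a b - Lm k i a b) / beta i)"
proof -
  define dUV where "dUV i = om k i / 2 * fsq d n (\<lambda>a b. U (Suc k) i a b - U k i a b)
                  + mu / 2 * fsq d n (\<lambda>a b. V (Suc k) i a b - V k i a b)" for i
  define dL where "dL i = fsq (rows i) n (\<lambda>a b. Lm (Suc k) i a b - Lm k i a b) / beta i" for i
  define w where "w l i = lam / 2 * fsq (rows i) d (W l i)" for l i
  define m where "m l i = fsq (rows i) n (Lm l i) / (2 * beta i)" for l i
  \<comment> \<open>The final letters follow the sweep: from \<open>PA\<close> to \<open>PD\<close>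
    the blocks \<open>V_{i-1}\<close>, \<open>U_i\<close>, \<open>V_i\<close> are replaced in turn,
    and from \<open>ha\<close> to \<open>he\<close> the blocks \<open>W_i\<close>,
    \<open>V_{i-1}\<close>, \<open>Z_i\<close>, \<open>Lm_i\<close>.\<close>
  define PA where "PA i = p i (v k (i-1)) (U k i) (V k i)" for i
  define PB where "PB i = p i (v (Suc k) (i-1)) (U k i) (V k i)" for i
  define PC where "PC i = p i (v (Suc k) (i-1)) (U (Suc k) i) (V k i)" for i
  define PD where "PD i = p i (v (Suc k) (i-1)) (U (Suc k) i) (V (Suc k) i)" for i
  define ha where "ha i = h i (W k i) (v k (i-1)) (Z k i) (Lm k i)" for i
  define hb where "hb i = h i (W (Suc k) i) (v k (i-1)) (Z k i) (Lm k i)" for i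
  define hc where "hc i = h i (W (Suc k) i) (v (Suc k) (i-1)) (Z k i) (Lm k i)" for i
  define hd where "hd i = h i (W (Suc k) i) (v (Suc k) (i-1)) (Z (Suc k) i) (Lm k i)" for i
  define he where "he i = h i (W (Suc k) i) (v (Suc k) (i-1)) (Z (Suc k) i) (Lm (Suc k) i)" for i
  \<comment> \<open>\<open>E i\<close> is the change that updating $V_{i-1}$ causes in the terms of layer \<open>i\<close>; it telescopes over the layers.\<close>
  define E where "E i = (if i = N then 0 else PB i - PA i) + (hc i - hb i)" for i
  \<comment> \<open>\<open>V_0 = X\<close> never changes, so the telescoping sum starts at 0; its
    other end \<open>hc N - hb N\<close> feeds the output step.\<close>
  have E1: "E 1 = 0"
    by (simp add: E_def PA_def PB_def hb_def hc_def)
  have EN: "E N = hc N - hb N" by (simp add: E_def)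
  have layer: "PD i + hd i + dUV i \<le> PA i + hb i - (E (Suc i) - E i)" if i: "i \<in> {1..N-1}" for i
  proof -
    have i': "1 \<le> i" "i \<le> N - 1" "i \<noteq> N" using i N3 by auto
    have "PC i + hd i + om k i / 2 * fsq d n (\<lambda>a b. U (Suc k) i a b - U k i a b) \<le> PB i + hc i"
      using U_descent[OF i'(1,2), of k] i'(3) by (simp add: PC_def PB_def hd_def hc_def)
    moreover have "PD i + mu / 2 * fsq d n (\<lambda>a b. V (Suc k) i a b - V k i a b) + E (Suc i) \<le> PC i"
      using V_descent[OF i'(1,2), of k] i'(1)
      by (auto simp: PC_def PD_def PA_def PB_def hc_def hb_def E_def fsq_minus_commute[of _ _ "V (Suc k) i"]
            split: if_splits)
    ultimately show ?thesis using i'(3) by (simp add: E_def dUV_def)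
  qed
  have tele: "(\<Sum>i=1..N-1. E (Suc i) - E i) = E N - E 1"
    using sum_Suc_diff[of 1 "N-1" E] N3 by simp
  have "(\<Sum>i=1..N-1. PD i + hd i + dUV i) \<le> (\<Sum>i=1..N-1. PA i + hb i - (E (Suc i) - E i))"
    by (rule sum_mono[OF layer])
  then have hidden: "(\<Sum>i=1..N-1. PD i) + (\<Sum>i=1..N-1. hd i) + (\<Sum>i=1..N-1. dUV i) + (hc N - hb N)
     \<le> (\<Sum>i=1..N-1. PA i) + (\<Sum>i=1..N-1. hb i)"
    unfolding sum.distrib sum_subtractf[of "\<lambda>i. PA i + hb i"] tele using E1 EN by simp
  have out: "fsq q n (\<lambda>a b. V (Suc k) N a b - Y a b) / 2 + hd N
     + (1 + beta N) / 2 * fsq q n (\<lambda>a b. V (Suc k) N a b - V k N a b)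
     = fsq q n (\<lambda>a b. V k N a b - Y a b) / 2 + hc N"
    using VN_descent[of k] by (simp add: hd_def hc_def)
  have split: "(\<Sum>i=1..N. f i) = (\<Sum>i=1..N-1. f i) + f N" for f :: "nat \<Rightarrow> real"
    using N3 sum.cl_ivl_Suc[of f 1 "N-1"] by simp
  have "(\<Sum>i=1..N. w (Suc k) i + hb i) \<le> (\<Sum>i=1..N. w k i + ha i)"
    by (rule sum_mono) (use W_descent in \<open>auto simp: w_def hb_def ha_def\<close>)
  then have ws: "(\<Sum>i=1..N. w (Suc k) i) + (\<Sum>i=1..N. hb i) \<le> (\<Sum>i=1..N. w k i) + (\<Sum>i=1..N. ha i)"
    unfolding sum.distrib .
  have "(\<Sum>i=1..N. he i - m (Suc k) i) = (\<Sum>i=1..N. hd i - m k i + dL i)"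
    by (rule sum.cong[OF refl]) (use Lm_ascent in \<open>auto simp: he_def hd_def m_def dL_def\<close>)
  then have ms: "(\<Sum>i=1..N. he i) - (\<Sum>i=1..N. m (Suc k) i) = (\<Sum>i=1..N. hd i) - (\<Sum>i=1..N. m k i) + (\<Sum>i=1..N. dL i)"
    unfolding sum.distrib sum_subtractf .
  have L1: "Lk (Suc k) = fsq q n (\<lambda>a b. V (Suc k) N a b - Y a b) / 2
       + ((\<Sum>i=1..N. w (Suc k) i) + (\<Sum>i=1..N. he i) - (\<Sum>i=1..N. m (Suc k) i)) + (\<Sum>i=1..N-1. PD i)"
    unfolding Lk_eq w_def he_def m_def PD_def sum.distrib sum_subtractf ..
  have L0: "Lk k = fsq q n (\<lambda>a b. V k N a b - Y a b) / 2
       + ((\<Sum>i=1..N. w k i) + (\<Sum>i=1..N. ha i) - (\<Sum>i=1..N. m k i)) + (\<Sum>i=1..N-1. PA i)"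
    unfolding Lk_eq w_def ha_def m_def PA_def sum.distrib sum_subtractf ..
  have "Lk (Suc k) + (\<Sum>i=1..N-1. dUV i)
       + (1 + beta N) / 2 * fsq q n (\<lambda>a b. V (Suc k) N a b - V k N a b) \<le> Lk k + (\<Sum>i=1..N. dL i)"
    using L1 L0 ms ws out hidden split[of hd] split[of hb] by linarith
  then show ?thesis unfolding dUV_def dL_def .
qed

subsection \<open>Lyapunov function\<close>

text \<open>Equal to \<open>psi2 * Pmax i + psi1^2\<close>, where \<open>Pmax i\<close> bounds the
  entries of the residual \<open>V_{i-1} + sig_i(U_i) - V_i\<close>: the product rule for that
  residual times \<open>sig_i'(U_i)\<close> gives this Lipschitz constant in
  \<open>U_i\<close>.\<close>

abbreviation alpha :: "nat \<Rightarrow> real" where "alpha i \<equiv> acoef psi0 psi1 psi2 Vmax i"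
abbreviation Pmax :: "nat \<Rightarrow> real" where "Pmax i \<equiv> Vmax (i-1) + psi0 + Vmax i"

text \<open>The third claim, multiplied by \<open>4 / beta i\<close>, says that the multiplier rise
  caused by U in this sweep and the amount stored for the next one together cost at most
  \<open>om / 4\<close>, half of what the proximal term yields.\<close>

lemma om_bounds:
  assumes "1 \<le> i" "i \<le> N - 1"
  shows "om k i \<ge> omin mu (beta i) (alpha i) (epsh i)"
    and "omin mu (beta i) (alpha i) (epsh i) > 0"
    and "(mu * alpha i + om k i)^2 + (om k i)^2 \<le> beta i * om k i / 16"
    and "om k i \<le> omax mu (beta i) (alpha i) (epsh i) (eps i)"
proof -
  \<comment> \<open>(A2) places \<open>om\<close> between the roots of $8w^2 - sw + 4\mu^2a_i^2$.\<close>
  define s where "s = beta i / 4 - 8 * mu * alpha i"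
  define S where "S = sqrt (Delta mu (beta i) (alpha i))"
  define w where "w = om k i"
  show 1: "om k i \<ge> omin mu (beta i) (alpha i) (epsh i)"
    and 2: "om k i \<le> omax mu (beta i) (alpha i) (epsh i) (eps i)"
    using A2_om[OF assms, of k] by auto
  show "omin mu (beta i) (alpha i) (epsh i) > 0"
    using A2_e[OF assms] by linarith
  have eh: "epsh i > 0" "S > 0" using A2_eh[OF assms] unfolding S_def by linarith+
  have lo: "16 * w - s \<ge> - S" using 1 eh unfolding omin_def s_def[symmetric] S_def[symmetric] w_def[symmetric] by (simp add: field_simps)
  have hi: "16 * w - s \<le> S" using 2 eh unfolding omax_def min.bounded_iff s_def[symmetric] S_def[symmetric] w_def[symmetric] by (simp add: field_simps)
  have "(16 * w - s)^2 \<le> S^2"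
    using lo hi eh(2) by (intro iffD1[OF abs_le_square_iff]) auto
  also have "S^2 = s^2 - 128 * mu^2 * (alpha i)^2"
    using eh(2) by (simp add: S_def Delta_def s_def)
  finally have "8 * w^2 - s * w + 4 * mu^2 * (alpha i)^2 \<le> 0"
    by (simp add: power2_eq_square algebra_simps)
  then show "(mu * alpha i + om k i)^2 + (om k i)^2 \<le> beta i * om k i / 16"
    unfolding w_def[symmetric] by (simp add: s_def power2_eq_square algebra_simps)
qed

lemma om_pos: "1 \<le> i \<Longrightarrow> i \<le> N - 1 \<Longrightarrow> om k i > 0"
  using om_bounds(1)[of i k] om_bounds(2)[of i] by linarith

section \<open>Bounds on the hidden multipliers and on their changes\<close>

lemma v_bound:
  assumes "i \<le> N - 1" "a < d" "b < n"
  shows "\<bar>v k i a b\<bar> \<le> Vmax i"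
proof -
  have "\<bar>v k i a b\<bar> \<le> frob d n (v k i)"
    using entry_sq_le_fsq[OF assms(2,3), of "v k i"] unfolding frob_def
    by (metis real_sqrt_abs real_sqrt_le_iff)
  also have "\<dots> \<le> Vmax i"
    using A3[of i k] Vmax0 assms by (cases "i = 0") auto
  finally show ?thesis .
qed

lemma residual_bound:
  assumes "1 \<le> i" "i \<le> N - 1" "a < d" "b < n"
  shows "\<bar>v k (i-1) a b + sig i x - v l i a b\<bar> \<le> Pmax i"
  using v_bound[of "i-1" a b k] v_bound[of i a b l] sig_b0[OF assms(1,2), of x] assms by linarith

text \<open>No bound on the changes of U is known at this stage, so that term stays explicit;
  \<open>lyap_lower\<close> absorbs it, and \<open>Lm_Bseq\<close> bounds it once square-summability
  is available.\<close>

lemma Lm_hidden_bound: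
  assumes "1 \<le> i" "i \<le> N - 1" "a < d" "b < n"
  shows "\<bar>Lm (Suc k) i a b\<bar> \<le> mu * Pmax i * psi1 + om k i * \<bar>U (Suc k) i a b - U k i a b\<bar>"
proof -
  have "\<bar>v (Suc k) (i-1) a b + sig i (U (Suc k) i a b) - V k i a b\<bar> * \<bar>deriv (sig i) (U (Suc k) i a b)\<bar> \<le> Pmax i * psi1"
    using residual_bound[OF assms, of "Suc k" "U (Suc k) i a b" k] sig_b1[of i "U (Suc k) i a b"] assms
    by (intro mult_mono) auto
  then have "mu * (\<bar>v (Suc k) (i-1) a b + sig i (U (Suc k) i a b) - V k i a b\<bar> * \<bar>deriv (sig i) (U (Suc k) i a b)\<bar>) \<le> mu * (Pmax i * psi1)"
    using mu_pos by (intro mult_left_mono) auto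
  then have "\<bar>mu * (v (Suc k) (i-1) a b + sig i (U (Suc k) i a b) - V k i a b) * deriv (sig i) (U (Suc k) i a b)\<bar> \<le> mu * Pmax i * psi1"
    using mu_pos by (simp add: abs_mult mult.assoc)
  moreover have "\<bar>om k i * (U (Suc k) i a b - U k i a b)\<bar> = om k i * \<bar>U (Suc k) i a b - U k i a b\<bar>"
    using om_pos[OF assms(1,2), of k] by (simp add: abs_mult)
  ultimately show ?thesis
    unfolding Lm_hidden[OF assms] by linarith
qed

text \<open>\<open>Lm_hidden\<close> at two consecutive sweeps. The proximal weights and the changes
  they multiply both differ between the sweeps, so the two proximal contributions are estimated
  separately.\<close>

lemma Lm_hidden_diff:
  assumes "1 \<le> i" "i \<le> N - 1" "a < d" "b < n"
  shows "\<bar>Lm (Suc (Suc k)) i a b - Lm (Suc k) i a b\<bar>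
    \<le> mu * psi1 * \<bar>v (Suc (Suc k)) (i-1) a b - v (Suc k) (i-1) a b\<bar>
      + mu * psi1 * \<bar>V (Suc k) i a b - V k i a b\<bar>
      + (mu * alpha i + om (Suc k) i) * \<bar>U (Suc (Suc k)) i a b - U (Suc k) i a b\<bar>
      + om k i * \<bar>U (Suc k) i a b - U k i a b\<bar>"
proof -
  note ip = assms(1,2)
  define x where "x = v (Suc (Suc k)) (i-1) a b"
  define x' where "x' = v (Suc k) (i-1) a b"
  define y where "y = V (Suc k) i a b"
  define y' where "y' = V k i a b"
  define u where "u = U (Suc (Suc k)) i a b"
  define u' where "u' = U (Suc k) i a b"
  define u0 where "u0 = U k i a b"
  define s where "s = sig i"
  define g where "g = deriv (sig i)"
  have P: "\<bar>x + s u - y\<bar> \<le> Pmax i"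
    using residual_bound[OF assms, of "Suc (Suc k)" u "Suc k"] ip by (simp add: x_def y_def s_def)
  have P0: "Pmax i \<ge> 0" using P by linarith
  have g': "\<bar>g u'\<bar> \<le> psi1" unfolding g_def by (rule sig_b1[OF ip])
  have gl: "\<bar>g u - g u'\<bar> \<le> psi2 * \<bar>u - u'\<bar>"
    unfolding g_def by (rule lipschitz_of_deriv_bound[OF sig_derivs(2)[OF ip] sig_b2[OF ip]])
  have sl: "\<bar>s u - s u'\<bar> \<le> psi1 * \<bar>u - u'\<bar>"
    unfolding s_def by (rule lipschitz_of_deriv_bound[OF sig_derivs(1)[OF ip] sig_b1[OF ip]])
  \<comment> \<open>Discrete product rule: the change of \<open>g\<close> is weighted with the
    bounded residual, the change of the residual with \<open>psi1\<close>. The two U-contributions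
    add up to \<open>alpha\<close>.\<close>
  have "(x + s u - y) * g u - (x' + s u' - y') * g u'
     = (x + s u - y) * (g u - g u') + ((x - x') + (s u - s u') - (y - y')) * g u'"
    by (simp add: algebra_simps)
  also have "\<bar>\<dots>\<bar> \<le> Pmax i * (psi2 * \<bar>u - u'\<bar>) + (\<bar>x - x'\<bar> + psi1 * \<bar>u - u'\<bar> + \<bar>y - y'\<bar>) * psi1"
  proof (rule order_trans[OF abs_triangle_ineq add_mono])
    show "\<bar>(x + s u - y) * (g u - g u')\<bar> \<le> Pmax i * (psi2 * \<bar>u - u'\<bar>)"
      unfolding abs_mult by (rule mult_mono[OF P gl P0]) simp
    show "\<bar>((x - x') + (s u - s u') - (y - y')) * g u'\<bar> \<le> (\<bar>x - x'\<bar> + psi1 * \<bar>u - u'\<bar> + \<bar>y - y'\<bar>) * psi1"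
      unfolding abs_mult by (rule mult_mono[OF _ g']) (use sl psi_pos in auto)
  qed
  also have "\<dots> = psi1 * \<bar>x - x'\<bar> + psi1 * \<bar>y - y'\<bar> + alpha i * \<bar>u - u'\<bar>"
    by (simp add: acoef_def power2_eq_square algebra_simps)
  finally have "mu * \<bar>(x + s u - y) * g u - (x' + s u' - y') * g u'\<bar>
      \<le> mu * (psi1 * \<bar>x - x'\<bar> + psi1 * \<bar>y - y'\<bar> + alpha i * \<bar>u - u'\<bar>)"
    using mu_pos by (intro mult_left_mono) auto
  then have "\<bar>mu * ((x + s u - y) * g u - (x' + s u' - y') * g u')\<bar>
      \<le> mu * psi1 * \<bar>x - x'\<bar> + mu * psi1 * \<bar>y - y'\<bar> + mu * alpha i * \<bar>u - u'\<bar>"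
    using mu_pos by (simp add: abs_mult[of mu] distrib_left mult.assoc)
  moreover have "\<bar>om (Suc k) i * (u - u')\<bar> = om (Suc k) i * \<bar>u - u'\<bar>" "\<bar>om k i * (u' - u0)\<bar> = om k i * \<bar>u' - u0\<bar>"
    using om_pos[OF ip, of k] om_pos[OF ip, of "Suc k"] by (simp_all add: abs_mult)
  moreover have "Lm (Suc (Suc k)) i a b - Lm (Suc k) i a b
     = mu * ((x + s u - y) * g u - (x' + s u' - y') * g u') + om (Suc k) i * (u - u') - om k i * (u' - u0)"
    unfolding Lm_hidden[OF assms]
    by (simp add: x_def x'_def y_def y'_def u_def u'_def u0_def s_def g_def algebra_simps)
  moreover have "(mu * alpha i + om (Suc k) i) * \<bar>u - u'\<bar> = mu * alpha i * \<bar>u - u'\<bar> + om (Suc k) i * \<bar>u - u'\<bar>"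
    by (simp add: algebra_simps)
  ultimately have "\<bar>Lm (Suc (Suc k)) i a b - Lm (Suc k) i a b\<bar>
    \<le> mu * psi1 * \<bar>x - x'\<bar> + mu * psi1 * \<bar>y - y'\<bar> + (mu * alpha i + om (Suc k) i) * \<bar>u - u'\<bar> + om k i * \<bar>u' - u0\<bar>"
    by linarith
  then show ?thesis by (simp add: x_def x'_def y_def y'_def u_def u'_def u0_def)
qed

definition tau :: "nat \<Rightarrow> real" where "tau i = 4 * mu^2 * psi1^2 / beta i"

definition dV :: "nat \<Rightarrow> nat \<Rightarrow> real" where "dV k i = fsq d n (\<lambda>a b. v (Suc k) i a b - v k i a b)"
definition dU :: "nat \<Rightarrow> nat \<Rightarrow> real" where "dU k i = fsq d n (\<lambda>a b. U (Suc k) i a b - U k i a b)"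
definition dL :: "nat \<Rightarrow> nat \<Rightarrow> real" where "dL k i = fsq (rows i) n (\<lambda>a b. Lm (Suc k) i a b - Lm k i a b)"
definition dVN :: "nat \<Rightarrow> real" where "dVN k = fsq q n (\<lambda>a b. V (Suc k) N a b - V k N a b)"

lemma d_nonneg [simp]: "dV k i \<ge> 0" "dU k i \<ge> 0" "dL k i \<ge> 0" "dVN k \<ge> 0"
  by (simp_all add: dV_def dU_def dL_def dVN_def)

lemma dV_0 [simp]: "dV k 0 = 0"
  by (simp add: dV_def fsq_def)

text \<open>This is (A1) with \<open>16 * mu * psi1^2\<close>, rearranged. Each V-step yields
  \<open>mu / 2\<close> and is charged twice, by its own layer and by the next one, so each charge
  has to stay below \<open>mu / 4\<close>.\<close>

lemma tau_less:
  assumes "1 \<le> i" "i \<le> N - 1"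
  shows "tau i < mu / 4"
proof -
  have "beta i > 16 * mu * psi1^2" "beta i > 0"
    using A1[OF assms] beta_pos[of i] assms by auto
  then have "mu * (16 * mu * psi1^2) < mu * beta i" using mu_pos by simp
  then show ?thesis
    using \<open>beta i > 0\<close> by (simp add: tau_def field_simps power2_eq_square)
qed

lemma tau_nonneg: "1 \<le> i \<Longrightarrow> i \<le> N - 1 \<Longrightarrow> tau i \<ge> 0"
  using beta_pos[of i] unfolding tau_def by (intro divide_nonneg_pos) auto

text \<open>\<open>V_{i-1}\<close> enters with the current sweep, being updated before
  \<open>U_i\<close>, but \<open>V_i\<close> with the previous one. The terms in
  \<open>dV k i\<close> and \<open>dU k i\<close> are those that \<open>lyap\<close> stores.\<close>

lemma dL_hidden_le:
  assumes "1 \<le> i" "i \<le> N - 1"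
  shows "dL (Suc k) i / beta i \<le> tau i * dV (Suc k) (i-1) + tau i * dV k i
      + 4 * (mu * alpha i + om (Suc k) i)^2 / beta i * dU (Suc k) i
      + 4 * (om k i)^2 / beta i * dU k i"
proof -
  have iN: "rows i = d" "i > 0" and b: "beta i > 0" using assms N3 beta_pos[of i] by (auto simp: rw_def)
  have "dL (Suc k) i \<le> 4 * (mu * psi1)^2 * dV (Suc k) (i-1) + 4 * (mu * psi1)^2 * dV k i
      + 4 * (mu * alpha i + om (Suc k) i)^2 * dU (Suc k) i + 4 * (om k i)^2 * dU k i"
    unfolding dL_def dV_def dU_def iN
  proof (rule fsq_le_sum4)
    fix a b assume ab: "a < d" "b < n"
    have "(Lm (Suc (Suc k)) i a b - Lm (Suc k) i a b)^2
      \<le> (mu * psi1 * \<bar>v (Suc (Suc k)) (i-1) a b - v (Suc k) (i-1) a b\<bar>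
      + mu * psi1 * \<bar>V (Suc k) i a b - V k i a b\<bar>
      + (mu * alpha i + om (Suc k) i) * \<bar>U (Suc (Suc k)) i a b - U (Suc k) i a b\<bar>
      + om k i * \<bar>U (Suc k) i a b - U k i a b\<bar>)^2"
      using Lm_hidden_diff[OF assms ab, of k]
      by (metis abs_ge_zero power2_abs power_mono)
    also note square_sum4_le
    finally show "(Lm (Suc (Suc k)) i a b - Lm (Suc k) i a b)^2
      \<le> 4 * (mu * psi1)^2 * (v (Suc (Suc k)) (i-1) a b - v (Suc k) (i-1) a b)^2
        + 4 * (mu * psi1)^2 * (v (Suc k) i a b - v k i a b)^2
        + 4 * (mu * alpha i + om (Suc k) i)^2 * (U (Suc (Suc k)) i a b - U (Suc k) i a b)^2
        + 4 * (om k i)^2 * (U (Suc k) i a b - U k i a b)^2"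
      using iN(2) by (simp add: power_mult_distrib)
  qed
  then have "dL (Suc k) i / beta i \<le> (4 * (mu * psi1)^2 * dV (Suc k) (i-1) + 4 * (mu * psi1)^2 * dV k i
      + 4 * (mu * alpha i + om (Suc k) i)^2 * dU (Suc k) i + 4 * (om k i)^2 * dU k i) / beta i"
    using b by (intro divide_right_mono) auto
  also have "\<dots> = tau i * dV (Suc k) (i-1) + tau i * dV k i
      + 4 * (mu * alpha i + om (Suc k) i)^2 / beta i * dU (Suc k) i
      + 4 * (om k i)^2 / beta i * dU k i"
    by (simp add: tau_def add_divide_distrib power_mult_distrib)
  finally show ?thesis .
qed

lemma dL_output: "dL (Suc k) N = dVN (Suc k)"
  unfolding dL_def dVN_def by (auto intro!: fsq_cong simp: Lm_output)

text \<open>Starts at \<open>Lk (Suc k)\<close> because the formula for the hidden multipliers holds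
  only after a first sweep. The sum is the previous-sweep part of \<open>dL_hidden_le\<close>, so
  that the next sweep finds it already paid.\<close>

definition lyap :: "nat \<Rightarrow> real" where
  "lyap k = Lk (Suc k) + (\<Sum>i=1..N-1. tau i * dV k i + 4 * (om k i)^2 / beta i * dU k i)"

definition dec :: "nat \<Rightarrow> real" where
  "dec k = (\<Sum>i=1..N-1. om (Suc k) i / 4 * dU (Suc k) i + (mu / 4 - tau i) * dV (Suc k) i)
     + ((1 + beta N) / 2 - 1 / beta N) * dVN (Suc k)"

lemma sum_split_last: "(\<Sum>i=1..N. f i) = (\<Sum>i=1..N-1. f i) + f N" for f :: "nat \<Rightarrow> real"
  using N3 sum.cl_ivl_Suc[of f 1 "N-1"] by simp

text \<open>Per layer, \<open>om / 4\<close> out of \<open>om / 2\<close> pays both U-charges and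
  the rest remains. Of \<open>mu / 2\<close>, one \<open>mu / 4\<close> pays the charge of layer
  \<open>i + 1\<close>; from the other, \<open>tau i\<close> is stored and
  \<open>mu / 4 - tau i\<close> remains.\<close>

lemma lyap_decrease: "lyap (Suc k) + dec k \<le> lyap k"
proof -
  have layer: "dL (Suc k) i / beta i + (tau i * dV (Suc k) i + 4 * (om (Suc k) i)^2 / beta i * dU (Suc k) i)
      + (om (Suc k) i / 4 * dU (Suc k) i + (mu / 4 - tau i) * dV (Suc k) i)
     \<le> (tau i * dV k i + 4 * (om k i)^2 / beta i * dU k i)
      + mu / 4 * dV (Suc k) (i-1) + om (Suc k) i / 2 * dU (Suc k) i + mu / 4 * dV (Suc k) i"
    if "i \<in> {1..N-1}" for i
  proof -
    have i: "1 \<le> i" "i \<le> N - 1" using that by auto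
    have b: "beta i > 0" using beta_pos[of i] i by simp
    have "(4 * (mu * alpha i + om (Suc k) i)^2 / beta i + 4 * (om (Suc k) i)^2 / beta i)
       \<le> om (Suc k) i / 4"
      using om_bounds(3)[OF i, of "Suc k"] b by (simp add: field_simps)
    then have "(4 * (mu * alpha i + om (Suc k) i)^2 / beta i + 4 * (om (Suc k) i)^2 / beta i) * dU (Suc k) i
       \<le> om (Suc k) i / 4 * dU (Suc k) i"
      by (rule mult_right_mono) simp
    moreover have "tau i * dV (Suc k) (i-1) \<le> mu / 4 * dV (Suc k) (i-1)"
      using tau_less[OF i] by (intro mult_right_mono) auto
    moreover note dL_hidden_le[OF i, of k]
    ultimately show ?thesis by (simp add: algebra_simps)
  qed
  \<comment> \<open>\<open>V_0\<close> does not move, so passing from index \<open>i - 1\<close> to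
    \<open>i\<close> only adds the nonnegative term of layer \<open>N - 1\<close>.\<close>
  have shift: "(\<Sum>i=1..N-1. mu / 4 * dV (Suc k) (i-1)) \<le> (\<Sum>i=1..N-1. mu / 4 * dV (Suc k) i)"
  proof -
    have "(\<Sum>i=1..N-1. mu / 4 * dV (Suc k) i) - (\<Sum>i=1..N-1. mu / 4 * dV (Suc k) (i-1))
        = (\<Sum>i=1..N-1. mu / 4 * dV (Suc k) (Suc i - 1) - mu / 4 * dV (Suc k) (i-1))"
      by (simp add: sum_subtractf)
    also have "\<dots> = mu / 4 * dV (Suc k) (N-1)"
      using sum_Suc_diff[of 1 "N-1" "\<lambda>i. mu / 4 * dV (Suc k) (i-1)"] N3 by simp
    finally show ?thesis using mu_pos d_nonneg(1)[of "Suc k" "N-1"]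
      by (smt (verit) mult_nonneg_nonneg divide_nonneg_pos)
  qed
  have hidden: "(\<Sum>i=1..N-1. dL (Suc k) i / beta i)
     + (\<Sum>i=1..N-1. tau i * dV (Suc k) i + 4 * (om (Suc k) i)^2 / beta i * dU (Suc k) i)
     + (\<Sum>i=1..N-1. om (Suc k) i / 4 * dU (Suc k) i + (mu / 4 - tau i) * dV (Suc k) i)
    \<le> (\<Sum>i=1..N-1. tau i * dV k i + 4 * (om k i)^2 / beta i * dU k i)
     + (\<Sum>i=1..N-1. mu / 4 * dV (Suc k) (i-1)) + (\<Sum>i=1..N-1. om (Suc k) i / 2 * dU (Suc k) i)
     + (\<Sum>i=1..N-1. mu / 4 * dV (Suc k) i)"
    unfolding sum.distrib[symmetric] by (rule sum_mono) (use layer in simp)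
  have "(\<Sum>i=1..N-1. om (Suc k) i / 2 * fsq d n (\<lambda>a b. U (Suc (Suc k)) i a b - U (Suc k) i a b)
                  + mu / 2 * fsq d n (\<lambda>a b. V (Suc (Suc k)) i a b - V (Suc k) i a b))
      = (\<Sum>i=1..N-1. om (Suc k) i / 2 * dU (Suc k) i) + (\<Sum>i=1..N-1. mu / 4 * dV (Suc k) i) + (\<Sum>i=1..N-1. mu / 4 * dV (Suc k) i)"
    unfolding sum.distrib[symmetric] by (rule sum.cong) (auto simp: dU_def dV_def)
  then have "Lk (Suc (Suc k))
     + ((\<Sum>i=1..N-1. om (Suc k) i / 2 * dU (Suc k) i) + (\<Sum>i=1..N-1. mu / 4 * dV (Suc k) i) + (\<Sum>i=1..N-1. mu / 4 * dV (Suc k) i))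
     + (1 + beta N) / 2 * dVN (Suc k)
   \<le> Lk (Suc k) + ((\<Sum>i=1..N-1. dL (Suc k) i / beta i) + dVN (Suc k) / beta N)"
    using Lag_descent[of "Suc k"] sum_split_last[of "\<lambda>i. dL (Suc k) i / beta i"]
    by (simp add: dL_def[symmetric] dVN_def[symmetric] dL_output)
  moreover have "((1 + beta N) / 2 - 1 / beta N) * dVN (Suc k) = (1 + beta N) / 2 * dVN (Suc k) - dVN (Suc k) / beta N"
    by (simp add: left_diff_distrib)
  ultimately show ?thesis
    using hidden shift unfolding lyap_def dec_def by linarith
qed

text \<open>Both fractions equal 1 at \<open>beta N = 1\<close>; above that value the decrease from
  the output block outweighs the rise from its multiplier.\<close>

lemma output_coeff_pos: "(1 + beta N) / 2 - 1 / beta N > 0"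
proof -
  have "1 / beta N < 1" "(1 + beta N) / 2 > 1" using A1N by simp_all
  then show ?thesis by linarith
qed

lemma dec_terms_nonneg:
  "i \<in> {1..N-1} \<Longrightarrow> om (Suc k) i / 4 * dU (Suc k) i \<ge> 0"
  "i \<in> {1..N-1} \<Longrightarrow> (mu / 4 - tau i) * dV (Suc k) i \<ge> 0"
  "((1 + beta N) / 2 - 1 / beta N) * dVN (Suc k) \<ge> 0"
  using om_pos[of i "Suc k"] tau_less[of i] output_coeff_pos by auto

lemma dec_ge:
  "i \<in> {1..N-1} \<Longrightarrow> om (Suc k) i / 4 * dU (Suc k) i \<le> dec k"
  "i \<in> {1..N-1} \<Longrightarrow> (mu / 4 - tau i) * dV (Suc k) i \<le> dec k"
  "((1 + beta N) / 2 - 1 / beta N) * dVN (Suc k) \<le> dec k"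
proof -
  note nn = dec_terms_nonneg[where k = k]
  have S: "(\<Sum>i=1..N-1. om (Suc k) i / 4 * dU (Suc k) i + (mu / 4 - tau i) * dV (Suc k) i) \<ge> 0"
    by (intro sum_nonneg add_nonneg_nonneg nn)
  show "((1 + beta N) / 2 - 1 / beta N) * dVN (Suc k) \<le> dec k"
    using S unfolding dec_def by linarith
  have *: "om (Suc k) i / 4 * dU (Suc k) i + (mu / 4 - tau i) * dV (Suc k) i \<le> dec k" if "i \<in> {1..N-1}"
  proof -
    have "om (Suc k) i / 4 * dU (Suc k) i + (mu / 4 - tau i) * dV (Suc k) i
       \<le> (\<Sum>i=1..N-1. om (Suc k) i / 4 * dU (Suc k) i + (mu / 4 - tau i) * dV (Suc k) i)"
      by (rule member_le_sum[OF that add_nonneg_nonneg[OF nn(1,2)]]) auto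
    then show ?thesis using nn(3) unfolding dec_def by linarith
  qed
  show "om (Suc k) i / 4 * dU (Suc k) i \<le> dec k" "(mu / 4 - tau i) * dV (Suc k) i \<le> dec k" if "i \<in> {1..N-1}"
    using *[OF that] nn(1,2)[OF that] by linarith+
qed

lemma dec_nonneg: "dec k \<ge> 0"
  using dec_ge(3)[of k] dec_terms_nonneg(3)[of k] by linarith

section \<open>Lower bound for the Lyapunov function\<close>

definition lower :: real where
  "lower = (\<Sum>i=1..N-1. (mu * Pmax i * psi1)^2 / beta i * fsq d n (\<lambda>a b. 1))"

text \<open>Only the terms \<open>- fsq Lm / (2 * beta)\<close> left by completing the square can be
  negative. In a hidden layer \<open>Lm_hidden_bound\<close> splits them into a constant, collected
  in \<open>lower\<close>, and a part in the change of U that the stored sum of \<open>lyap\<close>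
  covers. At the output the multiplier is \<open>V N - Y\<close>, which costs the fraction
  \<open>1 / beta N\<close> of the loss. What survives on the left later bounds W and
  \<open>V N\<close>.\<close>

lemma lyap_lower:
  "(\<Sum>i=1..N. lam / 2 * fsq (rows i) d (W (Suc k) i))
     + (1 - 1 / beta N) / 2 * fsq q n (\<lambda>a b. V (Suc k) N a b - Y a b) \<le> lyap k + lower"
proof -
  have h0: "h i A B C D \<ge> 0" if "1 \<le> i" "i \<le> N" for i A B C D
    using beta_pos[OF that] by (simp add: h_def)
  have p0: "p i A B C \<ge> 0" for i A B C
    using mu_pos by (simp add: p_def)
  have "(\<Sum>i=1..N. lam / 2 * fsq (rows i) d (W (Suc k) i) - fsq (rows i) n (Lm (Suc k) i) / (2 * beta i))
     \<le> (\<Sum>i=1..N. lam / 2 * fsq (rows i) d (W (Suc k) i) + h i (W (Suc k) i) (v (Suc k) (i-1)) (Z (Suc k) i) (Lm (Suc k) i)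
                   - fsq (rows i) n (Lm (Suc k) i) / (2 * beta i))"
    by (rule sum_mono) (use h0 in auto)
  moreover have "(\<Sum>i=1..N-1. p i (v (Suc k) (i-1)) (U (Suc k) i) (V (Suc k) i)) \<ge> 0"
    by (intro sum_nonneg p0)
  moreover have "fsq (rows N) n (Lm (Suc k) N) = fsq q n (\<lambda>a b. V (Suc k) N a b - Y a b)"
    by (auto intro!: fsq_cong simp: Lm_output)
  ultimately have 1: "fsq q n (\<lambda>a b. V (Suc k) N a b - Y a b) / 2
      + (\<Sum>i=1..N. lam / 2 * fsq (rows i) d (W (Suc k) i))
      - (\<Sum>i=1..N-1. fsq (rows i) n (Lm (Suc k) i) / (2 * beta i))
      - fsq q n (\<lambda>a b. V (Suc k) N a b - Y a b) / (2 * beta N) \<le> Lk (Suc k)"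
    unfolding Lk_eq sum_subtractf sum_split_last[of "\<lambda>i. fsq (rows i) n (Lm (Suc k) i) / (2 * beta i)"]
    by simp
  have layer: "fsq (rows i) n (Lm (Suc k) i) / (2 * beta i)
     \<le> (mu * Pmax i * psi1)^2 / beta i * fsq d n (\<lambda>a b. 1) + (tau i * dV k i + 4 * (om k i)^2 / beta i * dU k i)"
    if "i \<in> {1..N-1}" for i
  proof -
    have i: "1 \<le> i" "i \<le> N - 1" using that by auto
    have b: "beta i > 0" and iN: "rows i = d" using beta_pos[of i] i N3 by (auto simp: rw_def)
    have "fsq d n (Lm (Suc k) i) \<le> 2 * (mu * Pmax i * psi1)^2 * fsq d n (\<lambda>a b. 1) + 2 * (om k i)^2 * dU k i
        + 0 * fsq d n (\<lambda>a b. 0) + 0 * fsq d n (\<lambda>a b. 0)"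
      unfolding dU_def
    proof (rule fsq_le_sum4)
      fix a b assume ab: "a < d" "b < n"
      have "(Lm (Suc k) i a b)^2 \<le> (mu * Pmax i * psi1 + om k i * \<bar>U (Suc k) i a b - U k i a b\<bar>)^2"
        using Lm_hidden_bound[OF i ab, of k] by (metis abs_ge_zero power2_abs power_mono)
      also note square_sum2_le
      finally show "(Lm (Suc k) i a b)^2 \<le> 2 * (mu * Pmax i * psi1)^2 * 1^2
          + 2 * (om k i)^2 * (U (Suc k) i a b - U k i a b)^2 + 0 * 0^2 + 0 * 0^2"
        by (simp add: power_mult_distrib)
    qed
    then have "fsq d n (Lm (Suc k) i) / (2 * beta i)
       \<le> (2 * (mu * Pmax i * psi1)^2 * fsq d n (\<lambda>a b. 1) + 2 * (om k i)^2 * dU k i) / (2 * beta i)"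
      using b by (intro divide_right_mono) auto
    also have "\<dots> = (mu * Pmax i * psi1)^2 / beta i * fsq d n (\<lambda>a b. 1) + (om k i)^2 / beta i * dU k i"
      using b by (simp add: add_divide_distrib)
    also have "\<dots> \<le> (mu * Pmax i * psi1)^2 / beta i * fsq d n (\<lambda>a b. 1) + (tau i * dV k i + 4 * (om k i)^2 / beta i * dU k i)"
    proof -
      have "0 \<le> tau i * dV k i" using tau_nonneg[OF i] by simp
      moreover have "(om k i)^2 / beta i * dU k i \<le> 4 * (om k i)^2 / beta i * dU k i"
        using b by (intro mult_right_mono divide_right_mono) auto
      ultimately show ?thesis by linarith
    qed
    finally show ?thesis unfolding iN .
  qed
  have "(\<Sum>i=1..N-1. fsq (rows i) n (Lm (Suc k) i) / (2 * beta i))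
      \<le> lower + (\<Sum>i=1..N-1. tau i * dV k i + 4 * (om k i)^2 / beta i * dU k i)"
    unfolding lower_def sum.distrib[symmetric] by (rule sum_mono[OF layer])
  moreover have "(1 - 1 / beta N) / 2 * fsq q n (\<lambda>a b. V (Suc k) N a b - Y a b)
     = fsq q n (\<lambda>a b. V (Suc k) N a b - Y a b) / 2 - fsq q n (\<lambda>a b. V (Suc k) N a b - Y a b) / (2 * beta N)"
    by (simp add: field_simps)
  ultimately show ?thesis using 1 unfolding lyap_def by linarith
qed

lemma lower_terms_nonneg:
  "i \<in> {1..N} \<Longrightarrow> lam / 2 * fsq (rows i) d (W k i) \<ge> 0"
  "(1 - 1 / beta N) / 2 * fsq q n A \<ge> 0"
  using lam_pos A1N by auto

lemma lyap_ge: "0 \<le> lyap k + lower"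
proof -
  have "(\<Sum>i=1..N. lam / 2 * fsq (rows i) d (W (Suc k) i)) \<ge> 0"
    by (intro sum_nonneg lower_terms_nonneg(1))
  then show ?thesis
    using lyap_lower[of k] lower_terms_nonneg(2)[of "\<lambda>a b. V (Suc k) N a b - Y a b"] by linarith
qed

lemma lyap_le: "lyap k \<le> lyap 0"
proof (induction k)
  case (Suc k)
  then show ?case using lyap_decrease[of k] dec_nonneg[of k] by linarith
qed simp

section \<open>Summable decrease and square-summable block changes\<close>

lemma dec_summable: "summable dec"
proof (rule bounded_imp_summable[OF dec_nonneg])
  fix m
  have "(\<Sum>k\<le>m. dec k) + lyap (Suc m) \<le> lyap 0"
  proof (induction m)
    case 0
    then show ?case using lyap_decrease[of 0] by simp
  next
    case (Suc m)
    then show ?case using lyap_decrease[of "Suc m"] by simp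
  qed
  then show "(\<Sum>k\<le>m. dec k) \<le> lyap 0 + lower" using lyap_ge[of "Suc m"] by linarith
qed

lemma l2_of_dec:
  assumes "c > 0" "\<And>k. c * (f (Suc k))^2 \<le> dec k"
  shows "l2 f"
  using l2_of_summable_bound[OF dec_summable assms] unfolding l2_Suc_iff .

text \<open>The positive \<open>omin\<close> bounds the weights from below uniformly in
  \<open>k\<close>, which lets a single constant serve for all sweeps.\<close>

lemma U_diff_l2:
  assumes "1 \<le> i" "i \<le> N - 1" "a < d" "b < n"
  shows "l2 (\<lambda>k. U (Suc k) i a b - U k i a b)"
proof (rule l2_of_dec[of "omin mu (beta i) (alpha i) (epsh i) / 4"])
  fix k
  have "(U (Suc (Suc k)) i a b - U (Suc k) i a b)^2 \<le> dU (Suc k) i"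
    unfolding dU_def by (rule entry_sq_le_fsq[OF assms(3,4)])
  then have "omin mu (beta i) (alpha i) (epsh i) / 4 * (U (Suc (Suc k)) i a b - U (Suc k) i a b)^2 \<le> om (Suc k) i / 4 * dU (Suc k) i"
    using om_bounds(1)[OF assms(1,2), of "Suc k"] om_bounds(2)[OF assms(1,2)] by (intro mult_mono) auto
  also have "\<dots> \<le> dec k" using dec_ge(1) assms by simp
  finally show "omin mu (beta i) (alpha i) (epsh i) / 4 * (U (Suc (Suc k)) i a b - U (Suc k) i a b)^2 \<le> dec k" .
qed (use om_bounds(2)[OF assms(1,2)] in simp)

lemma v_diff_l2:
  assumes "i \<le> N - 1" "a < d" "b < n"
  shows "l2 (\<lambda>k. v (Suc k) i a b - v k i a b)"
proof (cases "i = 0")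
  case True
  then show ?thesis by (simp add: l2_zero)
next
  case False
  then have i: "1 \<le> i" "i \<le> N - 1" using assms by auto
  show ?thesis
  proof (rule l2_of_dec[of "mu / 4 - tau i"])
    fix k
    have "(v (Suc (Suc k)) i a b - v (Suc k) i a b)^2 \<le> dV (Suc k) i"
      unfolding dV_def by (rule entry_sq_le_fsq[OF assms(2,3)])
    then have "(mu / 4 - tau i) * (v (Suc (Suc k)) i a b - v (Suc k) i a b)^2 \<le> (mu / 4 - tau i) * dV (Suc k) i"
      using tau_less[OF i] by (intro mult_left_mono) auto
    also have "\<dots> \<le> dec k" using dec_ge(2) i by simp
    finally show "(mu / 4 - tau i) * (v (Suc (Suc k)) i a b - v (Suc k) i a b)^2 \<le> dec k" .
  qed (use tau_less[OF i] in simp)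
qed

lemma VN_diff_l2:
  assumes "a < q" "b < n"
  shows "l2 (\<lambda>k. V (Suc k) N a b - V k N a b)"
proof (rule l2_of_dec[OF output_coeff_pos])
  fix k
  have "(V (Suc (Suc k)) N a b - V (Suc k) N a b)^2 \<le> dVN (Suc k)"
    unfolding dVN_def by (rule entry_sq_le_fsq[OF assms])
  then have "((1 + beta N) / 2 - 1 / beta N) * (V (Suc (Suc k)) N a b - V (Suc k) N a b)^2
     \<le> ((1 + beta N) / 2 - 1 / beta N) * dVN (Suc k)"
    using output_coeff_pos by (intro mult_left_mono) auto
  also have "\<dots> \<le> dec k" by (rule dec_ge(3))
  finally show "((1 + beta N) / 2 - 1 / beta N) * (V (Suc (Suc k)) N a b - V (Suc k) N a b)^2 \<le> dec k" .
qed

lemma Z_diff_l2: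
  assumes "1 \<le> i" "i \<le> N" "a < rows i" "b < n"
  shows "l2 (\<lambda>k. Z (Suc k) i a b - Z k i a b)"
  using U_diff_l2[of i a b] VN_diff_l2[of a b] assms by (cases "i = N") auto

section \<open>Boundedness of the iterates\<close>

lemma om_Bseq:
  assumes "1 \<le> i" "i \<le> N - 1"
  shows "Bseq (\<lambda>k. om k i)"
  by (rule BseqI'[of _ "omax mu (beta i) (alpha i) (epsh i) (eps i)"])
     (use om_bounds(4)[OF assms] om_pos[OF assms] in \<open>simp add: abs_of_pos\<close>)

lemma v_Bseq:
  assumes "i \<le> N - 1" "a < d" "b < n"
  shows "Bseq (\<lambda>k. v k i a b)"
  by (rule BseqI'[of _ "Vmax i"]) (use v_bound[OF assms] in simp)

text \<open>(A3) says nothing about W; the bound comes from the regulariser, which survives in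
  \<open>lyap_lower\<close>, and from the monotonicity of \<open>lyap\<close>.\<close>

lemma W_Bseq:
  assumes "1 \<le> i" "i \<le> N" "a < rows i" "b < d"
  shows "Bseq (\<lambda>k. W k i a b)"
proof -
  have "\<bar>W (Suc k) i a b\<bar> \<le> sqrt (2 / lam * (lyap 0 + lower))" for k
  proof -
    have "lam / 2 * fsq (rows i) d (W (Suc k) i) \<le> (\<Sum>i=1..N. lam / 2 * fsq (rows i) d (W (Suc k) i))"
      by (rule member_le_sum) (use lower_terms_nonneg(1) assms in auto)
    then have "lam / 2 * fsq (rows i) d (W (Suc k) i) \<le> lyap 0 + lower"
      using lyap_lower[of k] lyap_le[of k] lower_terms_nonneg(2)[of "\<lambda>a b. V (Suc k) N a b - Y a b"] by linarith
    then have "fsq (rows i) d (W (Suc k) i) \<le> 2 / lam * (lyap 0 + lower)"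
      using lam_pos by (simp add: field_simps)
    then have "(W (Suc k) i a b)^2 \<le> 2 / lam * (lyap 0 + lower)"
      using entry_sq_le_fsq[OF assms(3,4), of "W (Suc k) i"] by linarith
    then show ?thesis by (metis real_sqrt_abs real_sqrt_le_iff)
  qed
  then have "Bseq (\<lambda>k. W (Suc k) i a b)" by (intro BseqI'[where K = "sqrt (2 / lam * (lyap 0 + lower))"]) auto
  then show ?thesis unfolding Bseq_Suc_iff[of "\<lambda>k. W k i a b"] .
qed

lemma VN_Bseq:
  assumes "a < q" "b < n"
  shows "Bseq (\<lambda>k. V (Suc k) N a b - Y a b)"
proof -
  define c where "c = (1 - 1 / beta N) / 2"
  have c: "c > 0" using A1N by (simp add: c_def)
  have "\<bar>V (Suc k) N a b - Y a b\<bar> \<le> sqrt ((lyap 0 + lower) / c)" for k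
  proof -
    have "(\<Sum>i=1..N. lam / 2 * fsq (rows i) d (W (Suc k) i)) \<ge> 0"
      by (intro sum_nonneg lower_terms_nonneg(1))
    then have "c * fsq q n (\<lambda>a b. V (Suc k) N a b - Y a b) \<le> lyap 0 + lower"
      using lyap_lower[of k] lyap_le[of k] unfolding c_def by linarith
    then have "fsq q n (\<lambda>a b. V (Suc k) N a b - Y a b) \<le> (lyap 0 + lower) / c"
      using c by (simp add: field_simps)
    then have "(V (Suc k) N a b - Y a b)^2 \<le> (lyap 0 + lower) / c"
      using entry_sq_le_fsq[OF assms, of "\<lambda>a b. V (Suc k) N a b - Y a b"] by linarith
    then show ?thesis by (metis real_sqrt_abs real_sqrt_le_iff)
  qed
  then show ?thesis by (intro BseqI'[where K = "sqrt ((lyap 0 + lower) / c)"]) auto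
qed

lemma Lm_Bseq:
  assumes "1 \<le> i" "i \<le> N" "a < rows i" "b < n"
  shows "Bseq (\<lambda>k. Lm k i a b)"
proof (cases "i = N")
  case True
  then have "Bseq (\<lambda>k. Lm (Suc k) i a b)" using assms VN_Bseq[of a b] by (simp add: Lm_output)
  then show ?thesis unfolding Bseq_Suc_iff[of "\<lambda>k. Lm k i a b"] .
next
  case False
  with assms have i: "1 \<le> i" "i \<le> N - 1" "a < d" "b < n" by auto
  obtain K where K: "\<And>k. om k i * \<bar>U (Suc k) i a b - U k i a b\<bar> \<le> K"
  proof -
    have "Bseq (\<lambda>k. om k i * \<bar>U (Suc k) i a b - U k i a b\<bar>)"
      by (rule l2_Bseq[OF l2_mult_Bseq[OF om_Bseq[OF i(1,2)] l2_abs[OF U_diff_l2[OF i]]]])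
    then obtain K where "\<And>k. \<bar>om k i * \<bar>U (Suc k) i a b - U k i a b\<bar>\<bar> \<le> K" by (auto simp: Bseq_def)
    then show ?thesis using that by (meson abs_ge_self order_trans)
  qed
  have "Bseq (\<lambda>k. Lm (Suc k) i a b)"
  proof (rule BseqI'[where K = "mu * Pmax i * psi1 + K"])
    fix k show "norm (Lm (Suc k) i a b) \<le> mu * Pmax i * psi1 + K"
      using Lm_hidden_bound[OF i, of k] K[of k] by simp
  qed
  then show ?thesis unfolding Bseq_Suc_iff[of "\<lambda>k. Lm k i a b"] .
qed

lemma Lm_diff_l2:
  assumes "1 \<le> i" "i \<le> N" "a < rows i" "b < n"
  shows "l2 (\<lambda>k. Lm (Suc k) i a b - Lm k i a b)"
proof (cases "i = N")
  case True
  then have "l2 (\<lambda>k. Lm (Suc (Suc k)) i a b - Lm (Suc k) i a b)"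
    using assms VN_diff_l2[of a b] l2_Suc_iff[of "\<lambda>k. V (Suc k) N a b - V k N a b"]
    by (simp add: Lm_output)
  then show ?thesis unfolding l2_Suc_iff[of "\<lambda>k. Lm (Suc k) i a b - Lm k i a b"] .
next
  case False
  with assms have i: "1 \<le> i" "i \<le> N - 1" "a < d" "b < n" and im: "i - 1 \<le> N - 1" by auto
  define g where "g k = mu * psi1 * \<bar>v (Suc (Suc k)) (i-1) a b - v (Suc k) (i-1) a b\<bar>
      + mu * psi1 * \<bar>V (Suc k) i a b - V k i a b\<bar>
      + (mu * alpha i + om (Suc k) i) * \<bar>U (Suc (Suc k)) i a b - U (Suc k) i a b\<bar>
      + om k i * \<bar>U (Suc k) i a b - U k i a b\<bar>" for k
  have om: "Bseq (\<lambda>k. om k i)" by (rule om_Bseq[OF i(1,2)])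
  then have "Bseq (\<lambda>k. om (Suc k) i)" by (simp add: Bseq_Suc_iff[of "\<lambda>k. om k i"])
  then have om': "Bseq (\<lambda>k. mu * alpha i + om (Suc k) i)" by (intro Bseq_plus) auto
  have du: "l2 (\<lambda>k. \<bar>U (Suc k) i a b - U k i a b\<bar>)" by (rule l2_abs[OF U_diff_l2[OF i]])
  have dv: "l2 (\<lambda>k. \<bar>v (Suc k) j a b - v k j a b\<bar>)" if "j \<le> N - 1" for j
    by (rule l2_abs[OF v_diff_l2[OF that i(3,4)]])
  have "l2 g"
    unfolding g_def
    using iffD2[OF l2_Suc_iff dv[OF im]] dv[OF i(2)] iffD2[OF l2_Suc_iff du] du om om' i(1)
    by (intro l2_add l2_cmult l2_mult_Bseq) auto
  then have "l2 (\<lambda>k. Lm (Suc (Suc k)) i a b - Lm (Suc k) i a b)"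
  proof (rule l2_comparison)
    fix k
    have "\<bar>Lm (Suc (Suc k)) i a b - Lm (Suc k) i a b\<bar> \<le> g k"
      unfolding g_def by (rule Lm_hidden_diff[OF i])
    then show "\<bar>Lm (Suc (Suc k)) i a b - Lm (Suc k) i a b\<bar> \<le> \<bar>g k\<bar>" by linarith
  qed
  then show ?thesis unfolding l2_Suc_iff[of "\<lambda>k. Lm (Suc k) i a b - Lm k i a b"] .
qed

subsection \<open>Gradient of the augmented Lagrangian\<close>

abbreviation zm :: mat where "zm \<equiv> \<lambda>a b. 0"

text \<open>Differentiates along an arbitrary curve in all four blocks at once; each partial
  derivative is then the case of a matrix unit in one block and zero velocity in the others.
  \<open>Vz zm DV\<close> expresses that \<open>V_0 = X\<close> has zero velocity.\<close>

lemma Lag_has_derivative: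
  assumes dW: "\<And>i a b. ((\<lambda>t. W' t i a b) has_real_derivative DW i a b) (at s)"
    and dU: "\<And>i a b. ((\<lambda>t. U' t i a b) has_real_derivative DU i a b) (at s)"
    and dV: "\<And>i a b. ((\<lambda>t. V' t i a b) has_real_derivative DV i a b) (at s)"
    and dL: "\<And>i a b. ((\<lambda>t. L' t i a b) has_real_derivative DL i a b) (at s)"
    and at_s: "W' s = W k" "U' s = U k" "V' s = V k" "L' s = Lm k"
  shows "((\<lambda>t. Lag N d q n X Y lam mu beta sig (W' t) (U' t) (V' t) (L' t)) has_real_derivative
     minner q n (\<lambda>a b. V k N a b - Y a b) (DV N)
     + (\<Sum>i=1..N. lam * minner (rows i) d (W k i) (DW i)
         + (minner (rows i) n (R k i) (DL i)
            + minner (rows i) n (\<lambda>a b. Lm k i a b + beta i * R k i a b)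
                (\<lambda>a b. mmul d (DW i) (v k (i-1)) a b + mmul d (W k i) (Vz zm DV (i-1)) a b
                   - (if i = N then DV N a b else DU i a b))))
     + mu * (\<Sum>i=1..N-1. minner d n (\<lambda>a b. v k (i-1) a b + sig i (U k i a b) - V k i a b)
         (\<lambda>a b. Vz zm DV (i-1) a b + deriv (sig i) (U k i a b) * DU i a b - DV i a b))) (at s)"
proof -
  have dVz: "((\<lambda>t. Vz X (V' t) j a b) has_real_derivative Vz zm DV j a b) (at s)" for j a b
    using dV by (cases "j = 0") (simp_all add: Vz_def)
  define RR where "RR t i = (\<lambda>a b. mmul d (W' t i) (Vz X (V' t) (i-1)) a b - (if i = N then V' t else U' t) i a b)" for t i
  define DR where "DR i = (\<lambda>a b. mmul d (DW i) (v k (i-1)) a b + mmul d (W k i) (Vz zm DV (i-1)) a b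
                   - (if i = N then DV N a b else DU i a b))" for i
  have RRs: "RR s i = R k i" for i
    by (simp add: RR_def R_def at_s v_def Z_def if_distrib[of "\<lambda>f. f _"] cong: if_cong)
  have dRR: "((\<lambda>t. RR t i a b) has_real_derivative DR i a b) (at s)" for i a b
    unfolding RR_def DR_def mmul_def v_def at_s[symmetric] sum.distrib[symmetric]
    using dU dV by (auto intro!: derivative_eq_intros DERIV_sum dW dVz simp: mult.commute)
  have dsig: "((\<lambda>t. sig i (U' t i a b)) has_real_derivative deriv (sig i) (U k i a b) * DU i a b) (at s)"
    if "i \<in> {1..N-1}" for i a b
    using DERIV_chain2[OF sig_derivs(1) dU, of i i a b] that by (simp add: at_s)
  have 1: "((\<lambda>t. fsq q n (\<lambda>a b. V' t N a b - Y a b) / 2) has_real_derivative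
      2 * minner q n (\<lambda>a b. V' s N a b - Y a b) (DV N) / 2) (at s)"
    by (intro DERIV_cdivide fsq_has_derivative) (auto intro!: derivative_eq_intros dV)
  have 2: "((\<lambda>t. \<Sum>i=1..N. lam / 2 * fsq (rows i) d (W' t i)
            + (minner (rows i) n (L' t i) (RR t i) + beta i / 2 * fsq (rows i) n (RR t i))) has_real_derivative
      (\<Sum>i=1..N. lam / 2 * (2 * minner (rows i) d (W' s i) (DW i))
         + ((minner (rows i) n (RR s i) (DL i) + minner (rows i) n (L' s i) (DR i))
            + beta i / 2 * (2 * minner (rows i) n (RR s i) (DR i))))) (at s)"
    by (intro DERIV_sum DERIV_add DERIV_cmult fsq_has_derivative minner_has_derivative dW dL dRR)
  have 3: "((\<lambda>t. mu / 2 * (\<Sum>i=1..N-1. fsq d n (\<lambda>a b. Vz X (V' t) (i-1) a b + sig i (U' t i a b) - V' t i a b)))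
      has_real_derivative
      mu / 2 * (\<Sum>i=1..N-1. 2 * minner d n (\<lambda>a b. Vz X (V' s) (i-1) a b + sig i (U' s i a b) - V' s i a b)
         (\<lambda>a b. Vz zm DV (i-1) a b + deriv (sig i) (U k i a b) * DU i a b - DV i a b))) (at s)"
    by (intro DERIV_sum DERIV_add DERIV_diff DERIV_cmult fsq_has_derivative dVz dV dsig)
  have Q: "minner r c L D + bet * minner r c A D = minner r c (\<lambda>a b. L a b + bet * A a b) D" for r c L D bet A
    by (simp add: minner_def sum.distrib sum_distrib_left algebra_simps)
  show ?thesis
    unfolding Lag_sum_split RR_def[symmetric]
    by (rule DERIV_cong[OF DERIV_add[OF DERIV_add[OF 1 2] 3]])
       (simp add: RRs at_s DR_def Q add.assoc v_def sum_distrib_left)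
qed

lemma upd_has_derivative:
  "((\<lambda>t. upd F i a b t j x y) has_real_derivative (if j = i then munit a b else zm) x y) (at s)"
  by (cases "j = i"; cases "x = a"; cases "y = b") (auto simp: upd_def munit_def)

lemma upd_self [simp]: "upd F i a b (F i a b) = F"
  by (simp add: upd_def)

abbreviation Lg where "Lg \<equiv> Lag N d q n X Y lam mu beta sig"

text \<open>Derivative of the constraint term of layer \<open>i\<close> with respect to its residual
  \<open>R\<close>; it enters the gradients in W, U and V.\<close>

definition Q :: "nat \<Rightarrow> nat \<Rightarrow> mat" where "Q k i = (\<lambda>a b. Lm k i a b + beta i * R k i a b)"

lemma grad_W:
  assumes "1 \<le> i" "i \<le> N" "a < rows i" "b < d"
  shows "deriv (\<lambda>t. Lg (upd (W k) i a b t) (U k) (V k) (Lm k)) (W k i a b)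
     = lam * W k i a b + (\<Sum>y<n. Q k i a y * v k (i-1) b y)"
proof -
  have Vz0: "Vz zm (\<lambda>_. zm) j = zm" for j by (simp add: Vz_def)
  have "(\<Sum>j=1..N. lam * minner (rows j) d (W k j) (if j = i then munit a b else zm)
         + (minner (rows j) n (R k j) zm
            + minner (rows j) n (Q k j)
                (\<lambda>x y. mmul d (if j = i then munit a b else zm) (v k (j-1)) x y + mmul d (W k j) (Vz zm (\<lambda>_. zm) (j-1)) x y
                   - (if j = N then 0 else 0))))
     = (\<Sum>j=1..N. if j = i then lam * W k i a b + (\<Sum>y<n. Q k i a y * v k (i-1) b y) else 0)"
    using assms by (intro sum.cong refl) (simp add: Vz0 minner_munit minner_mmul_munit_left)
  also have "\<dots> = lam * W k i a b + (\<Sum>y<n. Q k i a y * v k (i-1) b y)"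
    using assms by (simp add: sum.delta)
  finally show ?thesis
    by (intro DERIV_imp_deriv DERIV_cong[OF Lag_has_derivative[where k = k and DU = "\<lambda>_. zm" and DV = "\<lambda>_. zm" and DL = "\<lambda>_. zm",
            OF upd_has_derivative]])
       (auto simp: Q_def[symmetric] Vz0)
qed

lemma grad_U:
  assumes "1 \<le> i" "i \<le> N - 1" "a < d" "b < n"
  shows "deriv (\<lambda>t. Lg (W k) (upd (U k) i a b t) (V k) (Lm k)) (U k i a b)
     = mu * ((v k (i-1) a b + sig i (U k i a b) - V k i a b) * deriv (sig i) (U k i a b)) - Q k i a b"
proof -
  have Vz0: "Vz zm (\<lambda>_. zm) j = zm" for j by (simp add: Vz_def)
  have iN: "i \<noteq> N" "rows i = d" "i \<le> N" using assms N3 by (auto simp: rw_def)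
  have "minner r c A (\<lambda>x y. - munit a b x y) = - A a b" if "a < r" "b < c" for r c A
    using minner_scale_right[of r c A "-1" "munit a b"] minner_munit[OF that] by simp
  then have "(\<Sum>j=1..N. lam * minner (rows j) d (W k j) zm
         + (minner (rows j) n (R k j) zm
            + minner (rows j) n (Q k j)
                (\<lambda>x y. mmul d zm (v k (j-1)) x y + mmul d (W k j) (Vz zm (\<lambda>_. zm) (j-1)) x y
                   - (if j = N then 0 else (if j = i then munit a b else zm) x y))))
     = (\<Sum>j=1..N. if j = i then - Q k i a b else 0)"
    using assms iN by (intro sum.cong refl) (auto simp: Vz0)
  also have "\<dots> = - Q k i a b" using assms iN by (simp add: sum.delta)
  finally have 1: "(\<Sum>j=1..N. lam * minner (rows j) d (W k j) zm
         + (minner (rows j) n (R k j) zm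
            + minner (rows j) n (Q k j)
                (\<lambda>x y. mmul d zm (v k (j-1)) x y + mmul d (W k j) (Vz zm (\<lambda>_. zm) (j-1)) x y
                   - (if j = N then 0 else (if j = i then munit a b else zm) x y)))) = - Q k i a b" .
  have "minner d n A (\<lambda>x y. B x y * munit a b x y) = A a b * B a b" for A B
    using minner_munit[OF assms(3,4), of "\<lambda>x y. A x y * B x y"] by (simp add: minner_def mult.assoc)
  then have "(\<Sum>j=1..N-1. minner d n (\<lambda>x y. v k (j-1) x y + sig j (U k j x y) - V k j x y)
         (\<lambda>x y. Vz zm (\<lambda>_. zm) (j-1) x y + deriv (sig j) (U k j x y) * (if j = i then munit a b else zm) x y - 0))
    = (\<Sum>j=1..N-1. if j = i then (v k (i-1) a b + sig i (U k i a b) - V k i a b) * deriv (sig i) (U k i a b) else 0)"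
    by (intro sum.cong refl) (auto simp: Vz0)
  also have "\<dots> = (v k (i-1) a b + sig i (U k i a b) - V k i a b) * deriv (sig i) (U k i a b)"
    using assms by (simp add: sum.delta)
  finally have 2: "(\<Sum>j=1..N-1. minner d n (\<lambda>x y. v k (j-1) x y + sig j (U k j x y) - V k j x y)
         (\<lambda>x y. Vz zm (\<lambda>_. zm) (j-1) x y + deriv (sig j) (U k j x y) * (if j = i then munit a b else zm) x y - 0))
    = (v k (i-1) a b + sig i (U k i a b) - V k i a b) * deriv (sig i) (U k i a b)" .
  have z: "minner q n (\<lambda>a b. V k N a b - Y a b) zm = 0" by simp
  have "deriv (\<lambda>t. Lg (W k) (upd (U k) i a b t) (V k) (Lm k)) (U k i a b)
     = 0 + - Q k i a b + mu * ((v k (i-1) a b + sig i (U k i a b) - V k i a b) * deriv (sig i) (U k i a b))"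
    by (intro DERIV_imp_deriv DERIV_cong[OF Lag_has_derivative[where k = k and DW = "\<lambda>_. zm" and DV = "\<lambda>_. zm" and DL = "\<lambda>_. zm",
            OF _ upd_has_derivative]])
       (simp_all only: z 1 2 Q_def[symmetric] upd_self DERIV_const)
  then show ?thesis by simp
qed

text \<open>\<open>V_i\<close> occurs in the residual of layer \<open>i\<close> and, as an input,
  twice in layer \<open>i + 1\<close>: in the residual and in the linear constraint. The middle term
  is absent for the last hidden layer.\<close>

lemma grad_V:
  assumes "1 \<le> i" "i \<le> N - 1" "a < d" "b < n"
  shows "deriv (\<lambda>t. Lg (W k) (U k) (upd (V k) i a b t) (Lm k)) (V k i a b)
     = - mu * (v k (i-1) a b + sig i (U k i a b) - V k i a b)
       + mu_next i * (V k i a b + sig (Suc i) (U k (Suc i) a b) - V k (Suc i) a b)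
       + (\<Sum>x<rows (Suc i). Q k (Suc i) x b * W k (Suc i) x a)"
proof -
  define D where "D j = (if j = i then munit a b else zm)" for j
  have Vz0: "Vz zm D j = D j" for j using assms by (simp add: Vz_def D_def)
  have iN: "i \<noteq> N" "rows i = d" "i \<le> N" "Suc i \<le> N" using assms N3 by (auto simp: rw_def)
  have DN: "D N = zm" using iN by (simp add: D_def)
  have "(\<Sum>j=1..N. lam * minner (rows j) d (W k j) zm
         + (minner (rows j) n (R k j) zm
            + minner (rows j) n (Q k j)
                (\<lambda>x y. mmul d zm (v k (j-1)) x y + mmul d (W k j) (Vz zm D (j-1)) x y
                   - (if j = N then D N x y else 0))))
     = (\<Sum>j=1..N. if j = Suc i then (\<Sum>x<rows (Suc i). Q k (Suc i) x b * W k (Suc i) x a) else 0)"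
    unfolding DN Vz0 using assms iN
    by (intro sum.cong refl) (auto simp: D_def minner_mmul_munit_right)
  also have "\<dots> = (\<Sum>x<rows (Suc i). Q k (Suc i) x b * W k (Suc i) x a)" using iN by (simp add: sum.delta)
  finally have 1: "(\<Sum>j=1..N. lam * minner (rows j) d (W k j) zm
         + (minner (rows j) n (R k j) zm
            + minner (rows j) n (Q k j)
                (\<lambda>x y. mmul d zm (v k (j-1)) x y + mmul d (W k j) (Vz zm D (j-1)) x y
                   - (if j = N then D N x y else 0)))) = (\<Sum>x<rows (Suc i). Q k (Suc i) x b * W k (Suc i) x a)" .
  define P where "P j = (\<lambda>x y. v k (j-1) x y + sig j (U k j x y) - V k j x y)" for j
  have "(\<Sum>j=1..N-1. minner d n (P j) (\<lambda>x y. Vz zm D (j-1) x y + deriv (sig j) (U k j x y) * 0 - D j x y))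
    = (\<Sum>j=1..N-1. (if j = Suc i then P (Suc i) a b else 0) - (if j = i then P i a b else 0))"
    unfolding Vz0 mult_zero_right add_0_right minner_diff_right
    using assms by (intro sum.cong refl) (auto simp: D_def minner_munit)
  also have "\<dots> = (if Suc i = N then 0 else P (Suc i) a b) - P i a b"
    unfolding sum_subtractf using assms iN by (auto simp: sum.delta)
  finally have 2: "mu * (\<Sum>j=1..N-1. minner d n (P j) (\<lambda>x y. Vz zm D (j-1) x y + deriv (sig j) (U k j x y) * 0 - D j x y))
    = - mu * P i a b + mu_next i * P (Suc i) a b"
    by (simp add: mu_next_def right_diff_distrib)
  have up: "((\<lambda>t. upd (V k) i a b t j x y) has_real_derivative D j x y) (at s)" for j x y s
    unfolding D_def by (rule upd_has_derivative)
  have z: "minner q n (\<lambda>a b. V k N a b - Y a b) (D N) = 0" by (simp add: DN)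
  have "deriv (\<lambda>t. Lg (W k) (U k) (upd (V k) i a b t) (Lm k)) (V k i a b)
    = 0 + (\<Sum>x<rows (Suc i). Q k (Suc i) x b * W k (Suc i) x a) + (- mu * P i a b + mu_next i * P (Suc i) a b)"
    by (intro DERIV_imp_deriv DERIV_cong[OF Lag_has_derivative[where k = k and DW = "\<lambda>_. zm" and DU = "\<lambda>_. zm" and DL = "\<lambda>_. zm",
            OF _ _ up]])
       (simp_all only: 1 2 z P_def[symmetric] Q_def[symmetric] upd_self DERIV_const)
  then show ?thesis using assms by (simp add: P_def)
qed

lemma grad_VN:
  assumes "a < q" "b < n"
  shows "deriv (\<lambda>t. Lg (W k) (U k) (upd (V k) N a b t) (Lm k)) (V k N a b) = V k N a b - Y a b - Q k N a b"
proof -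
  define D where "D j = (if j = N then munit a b else zm)" for j
  have Vz0: "Vz zm D (j - Suc 0) = zm" "D N = munit a b" if "j \<le> N" for j using that N3 by (auto simp: Vz_def D_def)
  have "minner r c A (\<lambda>x y. - munit a b x y) = - A a b" if "a < r" "b < c" for r c A
    using minner_scale_right[of r c A "-1" "munit a b"] minner_munit[OF that] by simp
  then have "(\<Sum>j=1..N. lam * minner (rows j) d (W k j) zm
         + (minner (rows j) n (R k j) zm
            + minner (rows j) n (Q k j)
                (\<lambda>x y. mmul d zm (v k (j-1)) x y + mmul d (W k j) (Vz zm D (j-1)) x y
                   - (if j = N then D N x y else 0))))
     = (\<Sum>j=1..N. if j = N then - Q k N a b else 0)"
    using assms by (intro sum.cong refl) (auto simp: Vz0)
  also have "\<dots> = - Q k N a b" using N3 by (simp add: sum.delta)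
  finally have 1: "(\<Sum>j=1..N. lam * minner (rows j) d (W k j) zm
         + (minner (rows j) n (R k j) zm
            + minner (rows j) n (Q k j)
                (\<lambda>x y. mmul d zm (v k (j-1)) x y + mmul d (W k j) (Vz zm D (j-1)) x y
                   - (if j = N then D N x y else 0)))) = - Q k N a b" .
  have 2: "(\<Sum>j=1..N-1. minner d n (\<lambda>x y. v k (j-1) x y + sig j (U k j x y) - V k j x y)
      (\<lambda>x y. Vz zm D (j-1) x y + deriv (sig j) (U k j x y) * 0 - D j x y)) = 0"
    using N3 by (intro sum.neutral ballI) (auto simp: Vz0 D_def[of "_ :: nat"])
  have 3: "minner q n (\<lambda>a b. V k N a b - Y a b) (D N) = V k N a b - Y a b"
    using assms by (simp add: Vz0(2)[of N] minner_munit)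
  have up: "((\<lambda>t. upd (V k) N a b t j x y) has_real_derivative D j x y) (at s)" for j x y s
    unfolding D_def by (rule upd_has_derivative)
  have "deriv (\<lambda>t. Lg (W k) (U k) (upd (V k) N a b t) (Lm k)) (V k N a b)
    = V k N a b - Y a b + - Q k N a b + mu * 0"
    by (intro DERIV_imp_deriv DERIV_cong[OF Lag_has_derivative[where k = k and DW = "\<lambda>_. zm" and DU = "\<lambda>_. zm" and DL = "\<lambda>_. zm",
            OF _ _ up]])
       (simp_all only: 1 2 3 Q_def[symmetric] upd_self DERIV_const)
  then show ?thesis by simp
qed

lemma grad_Lm:
  assumes "1 \<le> i" "i \<le> N" "a < rows i" "b < n"
  shows "deriv (\<lambda>t. Lg (W k) (U k) (V k) (upd (Lm k) i a b t)) (Lm k i a b) = R k i a b"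
proof -
  have Vz0: "Vz zm (\<lambda>_. zm) j = zm" for j by (simp add: Vz_def)
  have "(\<Sum>j=1..N. lam * minner (rows j) d (W k j) zm
         + (minner (rows j) n (R k j) (if j = i then munit a b else zm)
            + minner (rows j) n (Q k j)
                (\<lambda>x y. mmul d zm (v k (j-1)) x y + mmul d (W k j) (Vz zm (\<lambda>_. zm) (j-1)) x y
                   - (if j = N then 0 else 0))))
     = (\<Sum>j=1..N. if j = i then R k i a b else 0)"
    using assms by (intro sum.cong refl) (simp add: Vz0 minner_munit)
  also have "\<dots> = R k i a b"
    using assms by (simp add: sum.delta)
  finally show ?thesis
    by (intro DERIV_imp_deriv DERIV_cong[OF Lag_has_derivative[where k = k and DW = "\<lambda>_. zm" and DU = "\<lambda>_. zm" and DV = "\<lambda>_. zm",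
            OF _ _ _ upd_has_derivative]])
       (auto simp: Q_def[symmetric] Vz0)
qed

subsection \<open>Square-summability of the gradient\<close>

text \<open>The multiplier step makes \<open>beta * R\<close> the last change of the multiplier, so
  \<open>Q\<close> is the multiplier up to a square-summable error.\<close>

lemma Q_eq:
  assumes "1 \<le> i" "i \<le> N" "a < rows i" "b < n"
  shows "Q (Suc k) i a b = Lm (Suc k) i a b + (Lm (Suc k) i a b - Lm k i a b)"
  using Lm_update[OF assms, of k] by (simp add: Q_def)

text \<open>Subtracting \<open>W_stationary\<close> leaves a difference of two products,
  \<open>Q\<close> with the new V and \<open>Q'\<close> with the old one, which splits into bounded
  sequences times square-summable ones.\<close>

lemma grad_W_l2:
  assumes "1 \<le> i" "i \<le> N" "a < rows i" "b < d"
  shows "l2 (\<lambda>k. deriv (\<lambda>t. Lg (upd (W (Suc k)) i a b t) (U (Suc k)) (V (Suc k)) (Lm (Suc k))) (W (Suc k) i a b))"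
proof -
  define Q' where "Q' k y = Lm k i a y + beta i * (mmul d (W (Suc k) i) (v k (i-1)) a y - Z k i a y)" for k y
  have im: "i - 1 \<le> N - 1" using assms by simp
  have W: "Bseq (\<lambda>k. W (Suc k) i a c)" if "c < d" for c
    using W_Bseq[OF assms(1,2,3) that] unfolding Bseq_Suc_iff[of "\<lambda>k. W k i a c"] .
  have Qdiff: "l2 (\<lambda>k. Q (Suc k) i a y - Q' k y)" if y: "y < n" for y
  proof -
    have eq: "Q (Suc k) i a y - Q' k y = (Lm (Suc k) i a y - Lm k i a y)
        + beta i * (\<Sum>c<d. W (Suc k) i a c * (v (Suc k) (i-1) c y - v k (i-1) c y)) - beta i * (Z (Suc k) i a y - Z k i a y)" for k
    proof -
      have "(\<Sum>c<d. W (Suc k) i a c * (v (Suc k) (i-1) c y - v k (i-1) c y))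
         = mmul d (W (Suc k) i) (v (Suc k) (i-1)) a y - mmul d (W (Suc k) i) (v k (i-1)) a y"
        unfolding mmul_def right_diff_distrib by (rule sum_subtractf)
      then show ?thesis
        unfolding Q_def Q'_def R_def by (simp only: right_diff_distrib)
    qed
    show ?thesis
      unfolding eq
    proof (rule l2_diff[OF l2_add[OF Lm_diff_l2[OF assms(1,2,3) y] l2_cmult] l2_cmult[OF Z_diff_l2[OF assms(1,2,3) y]]])
      show "l2 (\<lambda>k. \<Sum>c<d. W (Suc k) i a c * (v (Suc k) (i-1) c y - v k (i-1) c y))"
      proof (rule l2_sum)
        fix c assume "c \<in> {..<d}"
        then have c: "c < d" by simp
        show "l2 (\<lambda>k. W (Suc k) i a c * (v (Suc k) (i-1) c y - v k (i-1) c y))"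
          by (rule l2_mult_Bseq[OF W[OF c] v_diff_l2[OF im c y]])
      qed
    qed
  qed
  have Q'B: "Bseq (\<lambda>k. Q' k y)" if y: "y < n" for y
  proof -
    have L: "Bseq (\<lambda>k. Lm k i a y)" by (rule Lm_Bseq[OF assms(1,2,3) y])
    then have L': "Bseq (\<lambda>k. Lm (Suc k) i a y)" unfolding Bseq_Suc_iff[of "\<lambda>k. Lm k i a y"] .
    \<comment> \<open>\<open>Q'\<close> mixes old and new iterates and is bounded indirectly:
      \<open>Q\<close> is bounded and differs from it by a square-summable, hence bounded,
      sequence.\<close>
    have eq: "(\<lambda>k. Q' k y) = (\<lambda>k. (Lm (Suc k) i a y + (Lm (Suc k) i a y - Lm k i a y)) - (Q (Suc k) i a y - Q' k y))"
    proof
      fix k show "Q' k y = (Lm (Suc k) i a y + (Lm (Suc k) i a y - Lm k i a y)) - (Q (Suc k) i a y - Q' k y)"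
        using Q_eq[OF assms(1,2,3) y, of k] by linarith
    qed
    show ?thesis
      by (subst eq, rule Bseq_diff[OF Bseq_plus[OF L' Bseq_diff[OF L' L]] l2_Bseq[OF Qdiff[OF y]]])
  qed
  have eq: "deriv (\<lambda>t. Lg (upd (W (Suc k)) i a b t) (U (Suc k)) (V (Suc k)) (Lm (Suc k))) (W (Suc k) i a b)
     = (\<Sum>y<n. v (Suc k) (i-1) b y * (Q (Suc k) i a y - Q' k y) + Q' k y * (v (Suc k) (i-1) b y - v k (i-1) b y))" for k
  proof -
    have "(\<Sum>y<n. v (Suc k) (i-1) b y * (Q (Suc k) i a y - Q' k y) + Q' k y * (v (Suc k) (i-1) b y - v k (i-1) b y))
       = (\<Sum>y<n. Q (Suc k) i a y * v (Suc k) (i-1) b y - Q' k y * v k (i-1) b y)"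
      by (intro sum.cong refl) (simp add: right_diff_distrib)
    also have "\<dots> = (\<Sum>y<n. Q (Suc k) i a y * v (Suc k) (i-1) b y) - (\<Sum>y<n. Q' k y * v k (i-1) b y)"
      by (rule sum_subtractf)
    finally show ?thesis
      using W_stationary[OF assms, of k] grad_W[OF assms, of "Suc k"] unfolding Q'_def by linarith
  qed
  have "l2 (\<lambda>k. \<Sum>y<n. v (Suc k) (i-1) b y * (Q (Suc k) i a y - Q' k y) + Q' k y * (v (Suc k) (i-1) b y - v k (i-1) b y))"
  proof (rule l2_sum)
    fix y assume "y \<in> {..<n}"
    then have y: "y < n" by simp
    have v: "Bseq (\<lambda>k. v (Suc k) (i-1) b y)"
      using v_Bseq[OF im assms(4) y] unfolding Bseq_Suc_iff[of "\<lambda>k. v k (i-1) b y"] .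
    show "l2 (\<lambda>k. v (Suc k) (i-1) b y * (Q (Suc k) i a y - Q' k y) + Q' k y * (v (Suc k) (i-1) b y - v k (i-1) b y))"
      by (rule l2_add[OF l2_mult_Bseq[OF v Qdiff[OF y]] l2_mult_Bseq[OF Q'B[OF y] v_diff_l2[OF im assms(4) y]]])
  qed
  then show ?thesis unfolding eq .
qed

text \<open>With \<open>Q\<close> rewritten by \<open>Q_eq\<close> and the multiplier by
  \<open>Lm_hidden\<close>, the residuals cancel except that the gradient sees the new
  \<open>V_i\<close> where the subproblem saw the old one.\<close>

lemma grad_U_l2:
  assumes "1 \<le> i" "i \<le> N - 1" "a < d" "b < n"
  shows "l2 (\<lambda>k. deriv (\<lambda>t. Lg (W (Suc k)) (upd (U (Suc k)) i a b t) (V (Suc k)) (Lm (Suc k))) (U (Suc k) i a b))"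
proof -
  have iN: "i \<le> N" "rows i = d" "i > 0" using assms N3 by (auto simp: rw_def)
  have "Q (Suc k) i a b = Lm (Suc k) i a b + (Lm (Suc k) i a b - Lm k i a b)" for k
    using Q_eq[of i a b k] assms iN by simp
  then have eq: "deriv (\<lambda>t. Lg (W (Suc k)) (upd (U (Suc k)) i a b t) (V (Suc k)) (Lm (Suc k))) (U (Suc k) i a b)
    = - mu * (deriv (sig i) (U (Suc k) i a b) * (v (Suc k) i a b - v k i a b))
          - om k i * (U (Suc k) i a b - U k i a b) - (Lm (Suc k) i a b - Lm k i a b)" for k
    using iN(3) by (simp add: grad_U[OF assms] Lm_hidden[OF assms] algebra_simps)
  show ?thesis
    unfolding eq
  proof (rule l2_diff[OF l2_diff[OF l2_cmult[OF l2_mult_Bseq[OF _ v_diff_l2[OF assms(2-4)]]]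
          l2_mult_Bseq[OF om_Bseq[OF assms(1,2)] U_diff_l2[OF assms]]] Lm_diff_l2])
    show "Bseq (\<lambda>k. deriv (sig i) (U (Suc k) i a b))"
      by (rule BseqI'[of _ psi1]) (use assms sig_b1 in simp)
  qed (use assms iN in auto)
qed

text \<open>The stationarity condition already contains the new W and the new \<open>V_i\<close>, so
  their product cancels; only changes of the multiplier, of \<open>Z\<close> and of the next layer's
  residual remain.\<close>

lemma grad_V_l2:
  assumes "1 \<le> i" "i \<le> N - 1" "a < d" "b < n"
  shows "l2 (\<lambda>k. deriv (\<lambda>t. Lg (W (Suc k)) (U (Suc k)) (upd (V (Suc k)) i a b t) (Lm (Suc k))) (V (Suc k) i a b))"
proof -
  have iN: "Suc i \<le> N" "i > 0" using assms N3 by auto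
  \<comment> \<open>Change of the next layer's residual, due to the \<open>U\<close> and
    \<open>V\<close> of layer \<open>i + 1\<close> that were still old in the subproblem.\<close>
  define e where "e k = mu_next i * ((sig (Suc i) (U (Suc k) (Suc i) a b) - sig (Suc i) (U k (Suc i) a b))
           - (V (Suc k) (Suc i) a b - V k (Suc i) a b))" for k
  have e: "l2 e"
  proof (cases "Suc i = N")
    case True
    then show ?thesis by (simp add: e_def[abs_def] mu_next_def l2_zero)
  next
    case False
    then have j: "1 \<le> Suc i" "Suc i \<le> N - 1" using iN by auto
    have "l2 (\<lambda>k. sig (Suc i) (U (Suc k) (Suc i) a b) - sig (Suc i) (U k (Suc i) a b))"
    proof (rule l2_comparison[OF l2_cmult[OF U_diff_l2[OF j assms(3,4)], of psi1]])
      fix k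
      show "\<bar>sig (Suc i) (U (Suc k) (Suc i) a b) - sig (Suc i) (U k (Suc i) a b)\<bar>
          \<le> \<bar>psi1 * (U (Suc k) (Suc i) a b - U k (Suc i) a b)\<bar>"
        using lipschitz_of_deriv_bound[OF sig_derivs(1)[OF j] sig_b1[OF j]] psi_pos by (simp add: abs_mult)
    qed
    moreover have "l2 (\<lambda>k. V (Suc k) (Suc i) a b - V k (Suc i) a b)"
      using v_diff_l2[OF j(2) assms(3,4)] by simp
    ultimately show ?thesis unfolding e_def[abs_def] by (rule l2_cmult[OF l2_diff])
  qed
  have eq: "deriv (\<lambda>t. Lg (W (Suc k)) (U (Suc k)) (upd (V (Suc k)) i a b t) (Lm (Suc k))) (V (Suc k) i a b)
    = e k + (\<Sum>x<rows (Suc i). W (Suc k) (Suc i) x a *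
         ((Lm (Suc k) (Suc i) x b - Lm k (Suc i) x b) - beta (Suc i) * (Z (Suc k) (Suc i) x b - Z k (Suc i) x b)))" for k
  proof -
    let ?Q = "\<lambda>x. Lm k (Suc i) x b + beta (Suc i) * (mmul d (W (Suc k) (Suc i)) (V (Suc k) i) x b - Z k (Suc i) x b)"
    have "(\<Sum>x<rows (Suc i). W (Suc k) (Suc i) x a *
         ((Lm (Suc k) (Suc i) x b - Lm k (Suc i) x b) - beta (Suc i) * (Z (Suc k) (Suc i) x b - Z k (Suc i) x b)))
      = (\<Sum>x<rows (Suc i). Q (Suc k) (Suc i) x b * W (Suc k) (Suc i) x a - ?Q x * W (Suc k) (Suc i) x a)"
      using iN(2) by (intro sum.cong refl) (simp add: Q_def R_def algebra_simps)
    also have "\<dots> = (\<Sum>x<rows (Suc i). Q (Suc k) (Suc i) x b * W (Suc k) (Suc i) x a) - (\<Sum>x<rows (Suc i). ?Q x * W (Suc k) (Suc i) x a)"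
      by (rule sum_subtractf)
    finally show ?thesis
      using V_stationary[OF assms, of k] unfolding grad_V[OF assms] e_def by (simp add: algebra_simps)
  qed
  show ?thesis
    unfolding eq
  proof (rule l2_add[OF e l2_sum])
    fix x assume "x \<in> {..<rows (Suc i)}"
    then have x: "x < rows (Suc i)" "a < d" "1 \<le> Suc i" using assms by auto
    have W: "Bseq (\<lambda>k. W (Suc k) (Suc i) x a)"
      using W_Bseq[OF x(3) iN(1) x(1,2)] unfolding Bseq_Suc_iff[of "\<lambda>k. W k (Suc i) x a"] .
    show "l2 (\<lambda>k. W (Suc k) (Suc i) x a *
         ((Lm (Suc k) (Suc i) x b - Lm k (Suc i) x b) - beta (Suc i) * (Z (Suc k) (Suc i) x b - Z k (Suc i) x b)))"
      by (rule l2_mult_Bseq[OF W l2_diff[OF Lm_diff_l2[OF x(3) iN(1) x(1) assms(4)]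
              l2_cmult[OF Z_diff_l2[OF x(3) iN(1) x(1) assms(4)]]]])
  qed
qed

text \<open>By \<open>Lm_output\<close> the term \<open>V N - Y\<close> is the current multiplier,
  so only its last change is left.\<close>

lemma grad_VN_l2:
  assumes "a < q" "b < n"
  shows "l2 (\<lambda>k. deriv (\<lambda>t. Lg (W (Suc k)) (U (Suc k)) (upd (V (Suc k)) N a b t) (Lm (Suc k))) (V (Suc k) N a b))"
proof -
  have "deriv (\<lambda>t. Lg (W (Suc k)) (U (Suc k)) (upd (V (Suc k)) N a b t) (Lm (Suc k))) (V (Suc k) N a b)
    = - (Lm (Suc k) N a b - Lm k N a b)" for k
    using Q_eq[of N a b k] N3 assms by (simp add: grad_VN[OF assms] Lm_output[OF assms])
  then show ?thesis using l2_minus[OF Lm_diff_l2[of N a b]] N3 assms by simp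
qed

lemma grad_Lm_l2:
  assumes "1 \<le> i" "i \<le> N" "a < rows i" "b < n"
  shows "l2 (\<lambda>k. deriv (\<lambda>t. Lg (W (Suc k)) (U (Suc k)) (V (Suc k)) (upd (Lm (Suc k)) i a b t)) (Lm (Suc k) i a b))"
proof -
  have "R (Suc k) i a b = inverse (beta i) * (Lm (Suc k) i a b - Lm k i a b)" for k
    using beta_pos[OF assms(1,2)] by (simp add: Lm_update[OF assms])
  then show ?thesis
    unfolding grad_Lm[OF assms] by (simp only: l2_cmult[OF Lm_diff_l2[OF assms]])
qed

text \<open>The squared norm is a finite sum of squared entries, each summable from iterate 1 on;
  iterate 0, which satisfies no stationarity condition, is restored by the index shift.\<close>

lemma gradnorm_l2: "l2 (\<lambda>k. gradnorm N d q n Lg (W k) (U k) (V k) (Lm k))"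
proof -
  have V: "l2 (\<lambda>k. deriv (\<lambda>t. Lg (W (Suc k)) (U (Suc k)) (upd (V (Suc k)) i a b t) (Lm (Suc k))) (V (Suc k) i a b))"
    if "1 \<le> i" "i \<le> N" "a < rows i" "b < n" for i a b
    using that grad_V_l2[of i a b] grad_VN_l2[of a b] by (cases "i = N") auto
  have "l2 (\<lambda>k. gradnorm N d q n Lg (W (Suc k)) (U (Suc k)) (V (Suc k)) (Lm (Suc k)))"
    unfolding l2_def gradnorm_def
    by (subst real_sqrt_pow2, force intro!: add_nonneg_nonneg sum_nonneg)
       (intro summable_add summable_sum;
        use grad_W_l2 grad_U_l2 V grad_Lm_l2 in \<open>simp add: l2_def\<close>)
  then show ?thesis
    unfolding l2_Suc_iff[of "\<lambda>k. gradnorm N d q n Lg (W k) (U k) (V k) (Lm k)"] .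
qed

end

theorem mainTheorem14:
  fixes N d q n :: nat
    and X Y :: mat
    and lam mu psi0 psi1 psi2 :: real
    and beta :: "nat \<Rightarrow> real"
    and sig :: "nat \<Rightarrow> real \<Rightarrow> real"
    and Vmax epsh eps :: "nat \<Rightarrow> real"
    and om :: "nat \<Rightarrow> nat \<Rightarrow> real"
    and W U V Lm :: "nat \<Rightarrow> nat \<Rightarrow> mat"
  assumes N3: "N \<ge> 3"
    and lam_pos: "lam > 0" and mu_pos: "mu > 0"
    and beta_pos: "\<And>i. 1 \<le> i \<Longrightarrow> i \<le> N \<Longrightarrow> beta i > 0"
    and psi_pos: "psi0 > 0" "psi1 > 0" "psi2 > 0"
    and sig_an: "\<And>i. 1 \<le> i \<Longrightarrow> i \<le> N - 1 \<Longrightarrow> real_analytic (sig i)"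
    and sig_b0: "\<And>i x. 1 \<le> i \<Longrightarrow> i \<le> N - 1 \<Longrightarrow> \<bar>sig i x\<bar> \<le> psi0"
    and sig_b1: "\<And>i x. 1 \<le> i \<Longrightarrow> i \<le> N - 1 \<Longrightarrow> \<bar>deriv (sig i) x\<bar> \<le> psi1"
    and sig_b2: "\<And>i x. 1 \<le> i \<Longrightarrow> i \<le> N - 1 \<Longrightarrow> \<bar>deriv (deriv (sig i)) x\<bar> \<le> psi2"
    \<comment> \<open>initialisation (W^0 arbitrary)\<close>
    and init_U: "\<And>i. 1 \<le> i \<Longrightarrow> i \<le> N - 1 \<Longrightarrow> meq d n (U 0 i) (mmul d (W 0 i) (Vz X (V 0) (i-1)))"
    and init_V: "\<And>i. 1 \<le> i \<Longrightarrow> i \<le> N - 1 \<Longrightarrow>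
        meq d n (V 0 i) (\<lambda>a b. Vz X (V 0) (i-1) a b + sig i (U 0 i a b))"
    and init_VN: "meq q n (V 0 N) (mmul d (W 0 N) (V 0 (N-1)))"
    and init_L: "\<And>i. 1 \<le> i \<Longrightarrow> i \<le> N \<Longrightarrow> meq (rw N d q i) n (Lm 0 i) (\<lambda>a b. 0)"
    \<comment> \<open>(a) W-updates\<close>
    and step_W: "\<And>k i. k \<ge> 1 \<Longrightarrow> 1 \<le> i \<Longrightarrow> i \<le> N - 1 \<Longrightarrow>
        is_arg_min (\<lambda>Wi. lam / 2 * fsq d d Wi + beta i / 2 * fsq d n
            (\<lambda>a b. mmul d Wi (Vz X (V (k-1)) (i-1)) a b - U (k-1) i a b + Lm (k-1) i a b / beta i))
          (\<lambda>_. True) (W k i)"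
    and step_WN: "\<And>k. k \<ge> 1 \<Longrightarrow>
        is_arg_min (\<lambda>Wi. lam / 2 * fsq q d Wi + beta N / 2 * fsq q n
            (\<lambda>a b. mmul d Wi (V (k-1) (N-1)) a b - V (k-1) N a b + Lm (k-1) N a b / beta N))
          (\<lambda>_. True) (W k N)"
    \<comment> \<open>(b) U- and V-updates, i = 1..N-1 in order\<close>
    and step_U: "\<And>k i. k \<ge> 1 \<Longrightarrow> 1 \<le> i \<Longrightarrow> i \<le> N - 1 \<Longrightarrow>
        is_arg_min (\<lambda>Ui. mu / 2 * fsq d n (\<lambda>a b. Vz X (V k) (i-1) a b + sig i (Ui a b) - V (k-1) i a b)
            + beta i / 2 * fsq d n (\<lambda>a b. Ui a b - mmul d (W k i) (Vz X (V k) (i-1)) a b - Lm (k-1) i a b / beta i)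
            + om (k-1) i / 2 * fsq d n (\<lambda>a b. Ui a b - U (k-1) i a b))
          (\<lambda>_. True) (U k i)"
    and step_V: "\<And>k i. k \<ge> 1 \<Longrightarrow> 1 \<le> i \<Longrightarrow> i \<le> N - 2 \<Longrightarrow>
        is_arg_min (\<lambda>Vi. mu / 2 * fsq d n (\<lambda>a b. Vz X (V k) (i-1) a b + sig i (U k i a b) - Vi a b)
            + mu / 2 * fsq d n (\<lambda>a b. Vi a b + sig (i+1) (U (k-1) (i+1) a b) - V (k-1) (i+1) a b)
            + beta (i+1) / 2 * fsq d n (\<lambda>a b. mmul d (W k (i+1)) Vi a b - U (k-1) (i+1) a b
                                              + Lm (k-1) (i+1) a b / beta (i+1)))
          (\<lambda>_. True) (V k i)"
    and step_VN1: "\<And>k. k \<ge> 1 \<Longrightarrow>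
        is_arg_min (\<lambda>Vi. mu / 2 * fsq d n (\<lambda>a b. Vi a b - Vz X (V k) (N-2) a b - sig (N-1) (U k (N-1) a b))
            + beta N / 2 * fsq q n (\<lambda>a b. mmul d (W k N) Vi a b - V (k-1) N a b + Lm (k-1) N a b / beta N))
          (\<lambda>_. True) (V k (N-1))"
    \<comment> \<open>(c) V_N-update\<close>
    and step_VN: "\<And>k. k \<ge> 1 \<Longrightarrow> meq q n (V k N)
        (\<lambda>a b. (Y a b + beta N * mmul d (W k N) (V k (N-1)) a b + Lm (k-1) N a b) / (1 + beta N))"
    \<comment> \<open>(d) multiplier updates\<close>
    and step_L: "\<And>k i. k \<ge> 1 \<Longrightarrow> 1 \<le> i \<Longrightarrow> i \<le> N - 1 \<Longrightarrow> meq d n (Lm k i)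
        (\<lambda>a b. Lm (k-1) i a b + beta i * (mmul d (W k i) (Vz X (V k) (i-1)) a b - U k i a b))"
    and step_LN: "\<And>k. k \<ge> 1 \<Longrightarrow> meq q n (Lm k N)
        (\<lambda>a b. Lm (k-1) N a b + beta N * (mmul d (W k N) (V k (N-1)) a b - V k N a b))"
    \<comment> \<open>bounds V_i^max\<close>
    and Vmax0: "Vmax 0 > frob d n X"
    and Vmax_pos: "\<And>i. 1 \<le> i \<Longrightarrow> i \<le> N - 1 \<Longrightarrow> Vmax i > 0"
    \<comment> \<open>(A1)\<close>
    and A1: "\<And>i. 1 \<le> i \<Longrightarrow> i \<le> N - 1 \<Longrightarrow>
        beta i > max (32 * (1 + sqrt 2) * mu * acoef psi0 psi1 psi2 Vmax i) (16 * mu * psi1^2)"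
    and A1N: "beta N > 1"
    \<comment> \<open>(A2)\<close>
    and A2_eh: "\<And>i. 1 \<le> i \<Longrightarrow> i \<le> N - 1 \<Longrightarrow>
        0 < epsh i \<and> epsh i < sqrt (Delta mu (beta i) (acoef psi0 psi1 psi2 Vmax i)) / 32"
    and A2_e: "\<And>i. 1 \<le> i \<Longrightarrow> i \<le> N - 1 \<Longrightarrow>
        0 < eps i \<and> eps i < omin mu (beta i) (acoef psi0 psi1 psi2 Vmax i) (epsh i) / 4"
    and A2_om: "\<And>k i. 1 \<le> i \<Longrightarrow> i \<le> N - 1 \<Longrightarrow>
        omin mu (beta i) (acoef psi0 psi1 psi2 Vmax i) (epsh i) < om k i
        \<and> om k i \<le> om (Suc k) i
        \<and> om (Suc k) i < omax mu (beta i) (acoef psi0 psi1 psi2 Vmax i) (epsh i) (eps i)"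
    \<comment> \<open>(A3)\<close>
    and A3: "\<And>k i. 1 \<le> i \<Longrightarrow> i \<le> N - 1 \<Longrightarrow> frob d n (V k i) \<le> Vmax i"
  shows "\<exists>c>0. \<forall>k\<ge>1.
      (1 / real k) * (\<Sum>l=1..k. gradnorm N d q n (Lag N d q n X Y lam mu beta sig) (W l) (U l) (V l) (Lm l))
        \<le> c / sqrt (real k)
    \<and> Min ((\<lambda>l. gradnorm N d q n (Lag N d q n X Y lam mu beta sig) (W l) (U l) (V l) (Lm l)) ` {1..k})
        \<le> c / sqrt (real k)"
proof -
  interpret admm N d q n X Y lam mu psi0 psi1 psi2 beta sig Vmax epsh eps om W U V Lm
    by unfold_locales (fact assms)+
  show ?thesis by (rule average_and_min_le_of_l2[OF gradnorm_l2])
qed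

end
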